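(* Fix an integer $b\ge2$ and $\gamma\in(0,1)$, and let $\phi:\mathbb{R}\to\mathbb{R}$ be a $\mathbb{Z}$-periodic Lipschitz function satisfying condition (H). Let $\alpha\in[0,1]$ be the constant such that $m_x$ is exact dimensional with $\dim(m_x)=\alpha$ for Lebesgue-a.e. $x\in[0,1]$. Then for any $\varepsilon>0$ there is $M_1(\varepsilon)$, for any $m\ge M_1(\varepsilon)$ there is $K_1(\varepsilon,m)$, and for any $k\ge K_1(\varepsilon,m)$ there is $N_1(\varepsilon,m,k)$ such that for every $n\ge N_1(\varepsilon,m,k)$, $$\nu^n\big(\{\mathbf{i}\in\Lambda^n:\ m_{\mathbf{i}(0)}\text{ is }(\alpha,\varepsilon,m)\text{-entropy porous from scale }1\text{ to }k\}\big)>1-\varepsilon.$$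
   Context: $\Lambda=\{0,\dots,b-1\}$, $\Sigma=\Lambda^{\mathbb{Z}_+}$, $\nu$ uniform on $\Lambda$. $S(x,\mathbf{j})=\sum_{n\ge1}\gamma^{n-1}\phi\big(\frac{x+j_1+j_2b+\cdots+j_nb^{n-1}}{b^n}\big)$ for $\mathbf{j}\in\Sigma$, $x\in[0,1]$; condition (H): for all $\mathbf{i}\neq\mathbf{j}\in\Sigma$, $x\mapsto S(x,\mathbf{j})-S(x,\mathbf{i})$ is not identically zero. $m_x$ is the image of $\nu^{\mathbb{Z}_+}$ under $\mathbf{j}\mapsto S(x,\mathbf{j})$ (the existence of $\alpha$ is known). For $\mathbf{i}\in\Lambda^n$ and $x\in[0,1]$, $\mathbf{i}(x)=\frac{x+i_1+i_2b+\cdots+i_nb^{n-1}}{b^n}$. $\mathcal{L}_n$ is the partition of $\mathbb{R}$ into intervals $[j/b^n,(j+1)/b^n)$, $j\in\mathbb{Z}$; $H(\mu,\mathcal{Q})=-\sum_{Q\in\mathcal{Q}}\mu(Q)\log_b\mu(Q)$. For $\mu$ a probability on $\mathbb{R}$, $\mu_{x,i}$ is $\mu$ restricted to the $\mathcal{L}_i$-interval containing $x$ and normalized. $\mu$ is $(h,\delta,m)$-entropy porous from scale $n_1$ to $n_2$ if $\frac{1}{n_2-n_1+1}\sum_{i=n_1}^{n_2}\mu\big(\{x:\frac1mH(\mu_{x,i},\mathcal{L}_{i+m})<h+\delta\}\big)>1-\delta$. *)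

theory Defs
  imports "HOL-Probability.Probability"
begin

text \<open>Digit sequences j in Sigma are represented 0-indexed: j 0 = j_1, j 1 = j_2, ...\<close>

definition Sfun :: "nat \<Rightarrow> real \<Rightarrow> (real \<Rightarrow> real) \<Rightarrow> real \<Rightarrow> (nat \<Rightarrow> nat) \<Rightarrow> real" where
  "Sfun b \<gamma> \<phi> x j =
     (\<Sum>n. \<gamma> ^ n * \<phi> ((x + (\<Sum>k<Suc n. real (j k) * real b ^ k)) / real b ^ Suc n))"

definition seq_measure :: "nat \<Rightarrow> (nat \<Rightarrow> nat) measure" where
  "seq_measure b = (\<Pi>\<^sub>M k\<in>(UNIV::nat set). measure_pmf (pmf_of_set {0..<b}))"

definition mx :: "nat \<Rightarrow> real \<Rightarrow> (real \<Rightarrow> real) \<Rightarrow> real \<Rightarrow> real measure" where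
  "mx b \<gamma> \<phi> x = distr (seq_measure b) borel (Sfun b \<gamma> \<phi> x)"

definition condH :: "nat \<Rightarrow> real \<Rightarrow> (real \<Rightarrow> real) \<Rightarrow> bool" where
  "condH b \<gamma> \<phi> \<longleftrightarrow>
     (\<forall>i j. (\<forall>k. i k < b) \<longrightarrow> (\<forall>k. j k < b) \<longrightarrow> i \<noteq> j \<longrightarrow>
        (\<exists>x\<in>{0..1}. Sfun b \<gamma> \<phi> x j - Sfun b \<gamma> \<phi> x i \<noteq> 0))"

definition exact_dimensional :: "real measure \<Rightarrow> real \<Rightarrow> bool" where
  "exact_dimensional \<mu> \<alpha> \<longleftrightarrow>
     (AE y in \<mu>. ((\<lambda>r. ln (measure \<mu> (ball y r)) / ln r) \<longlongrightarrow> \<alpha>) (at_right 0))"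

definition badic :: "nat \<Rightarrow> nat \<Rightarrow> int \<Rightarrow> real set" where
  "badic b n j = {real_of_int j / real b ^ n ..< (real_of_int j + 1) / real b ^ n}"

definition badic_cell :: "nat \<Rightarrow> nat \<Rightarrow> real \<Rightarrow> real set" where
  "badic_cell b n x = badic b n \<lfloor>real b ^ n * x\<rfloor>"

definition restr_norm :: "real measure \<Rightarrow> nat \<Rightarrow> nat \<Rightarrow> real \<Rightarrow> real set \<Rightarrow> real" where
  "restr_norm \<mu> b i x A = measure \<mu> (A \<inter> badic_cell b i x) / measure \<mu> (badic_cell b i x)"

definition part_entropy :: "nat \<Rightarrow> (real set \<Rightarrow> real) \<Rightarrow> nat \<Rightarrow> real" where
  "part_entropy b P n = (\<Sum>\<^sub>\<infinity>j::int. - P (badic b n j) * log (real b) (P (badic b n j)))"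

definition entropy_porous ::
  "nat \<Rightarrow> real measure \<Rightarrow> real \<Rightarrow> real \<Rightarrow> nat \<Rightarrow> nat \<Rightarrow> nat \<Rightarrow> bool" where
  "entropy_porous b \<mu> h \<delta> m n1 n2 \<longleftrightarrow>
     (1 / (real n2 - real n1 + 1)) *
       (\<Sum>i=n1..n2. measure \<mu>
          {x. (1 / real m) * part_entropy b (restr_norm \<mu> b i x) (i + m) < h + \<delta>})
     > 1 - \<delta>"

definition words :: "nat \<Rightarrow> nat \<Rightarrow> nat list set" where
  "words b n = {w. length w = n \<and> set w \<subseteq> {0..<b}}"

definition word_map :: "nat \<Rightarrow> nat list \<Rightarrow> real \<Rightarrow> real" where
  "word_map b w x = (x + (\<Sum>k<length w. real (w ! k) * real b ^ k)) / real b ^ length w"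

end

theory Submission
  imports Defs
begin

text \<open>
  For a b-adic cell c of level i let h(c) be the entropy of the conditional measure on c with
  respect to level i + m, divided by m. Telescoping shows that the average of h over the cells
  (weighted by mass) and over the levels 1, ..., k is about H(m_x, L_k) / k, hence at most
  about alpha. On the other hand m_x is an average of pieces, translated copies of m_y scaled by
  \<gamma>^p with \<gamma>^p comparable to b^-i. By the log-sum inequality and exact dimensionality of
  most m_y, the contribution of any family of cells of total mass t to the average is at least
  about t alpha. Applied to the cells with h(c) < alpha + \<epsilon>, this forces the cells with
  h(c) \<ge> alpha + \<epsilon> to have small mass.

  Exact dimensionality is only known almost everywhere, whereas the points w(0) are b-adic
  rationals; since x \<mapsto> S(x, j) is Lipschitz uniformly in j, ball masses at w(0) are
  controlled by those at nearby points, and averages over words become Lebesgue integrals.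
\<close>

section \<open>The random sums and their recursion\<close>

text \<open>The order of the quantifiers records who pays for which loss. The lower bound costs, at
  each level, a fixed amount of entropy for cutting the pieces, harmless after division by m, and
  the mass of the points whose balls of radius about b^-m are too heavy, small in the mean for large
  m. The shifted telescoping leaves only the m levels k+1, ..., k+m, of entropy about k \<alpha>
  each once k is large compared with m. Finally n makes the cylinders much shorter than the finest
  scale b^-(k+m).

  No ergodic argument is needed for the pieces at varying levels: the base point of the piece u of
  the measure at w(0) is (w @ u)(0), and w @ u runs over all words of a greater length. So one
  Lebesgue integral bounds the heavy mass at every level i, whatever generation p is used there.

  All errors are controlled only in the mean over words, so the total mass of the high-entropy cells
  is bounded in the mean first, and Markov's inequality then selects the good words. One factor
  \<epsilon> is spent on the entropy gap, one on the porosity threshold, one on the proportion of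
  words; hence the cubic tolerance \<open>e\<close>.\<close>

lemma prob_space_seq_measure: "prob_space (seq_measure b)"
  unfolding seq_measure_def by (intro prob_space_PiM prob_space_measure_pmf)

lemma space_seq_measure [simp]: "space (seq_measure b) = UNIV"
  by (simp add: seq_measure_def space_PiM)

lemma measurable_digit [measurable]: "(\<lambda>j. real (j k)) \<in> borel_measurable (seq_measure b)"
proof -
  have "(\<lambda>j. j k) \<in> seq_measure b \<rightarrow>\<^sub>M measure_pmf (pmf_of_set {0..<b})"
    unfolding seq_measure_def by (rule measurable_component_singleton) simp
  then show ?thesis
    by (rule measurable_compose) simp
qed

text \<open>\<open>K\<close> bounds \<phi> and \<open>A\<close> bounds all the sums S.
  \<open>A\<close> is a natural number so that [-\<open>A\<close>, \<open>A\<close>) is exactly a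
  union of b-adic cells at every level.\<close>

locale weierstrass =
  fixes b :: nat and \<gamma> :: real and \<phi> :: "real \<Rightarrow> real" and L K :: real and A :: nat
  assumes b2: "2 \<le> b" and \<gamma>0: "0 < \<gamma>" and \<gamma>1: "\<gamma> < 1"
    and lip: "L-lipschitz_on UNIV \<phi>"
    and bounded: "\<bar>\<phi> x\<bar> \<le> K"
    and A_gt: "K / (1 - \<gamma>) < real A"
begin

abbreviation "\<Omega> \<equiv> seq_measure b"
abbreviation "S \<equiv> Sfun b \<gamma> \<phi>"
abbreviation "\<mu> \<equiv> mx b \<gamma> \<phi>"

sublocale prob_space "\<Omega>" by (rule prob_space_seq_measure)

lemma b_pos: "0 < real b" "1 < real b" "0 < b" using b2 by auto

lemma L_nonneg: "0 \<le> L" using lip by (rule lipschitz_on_nonneg)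

lemma phi_measurable [measurable]: "\<phi> \<in> borel_measurable borel"
  using lip by (intro borel_measurable_continuous_onI lipschitz_on_continuous_on)

lemma summable_S: "summable (\<lambda>n. \<gamma> ^ n * \<phi> (f n))"
proof (rule summable_comparison_test')
  show "summable (\<lambda>n. \<gamma> ^ n * K)" using \<gamma>0 \<gamma>1 by (intro summable_mult2 summable_geometric) auto
  show "norm (\<gamma> ^ n * \<phi> (f n)) \<le> \<gamma> ^ n * K" for n
    using bounded[of "f n"] \<gamma>0 by (auto simp: abs_mult intro!: mult_left_mono)
qed

lemma suminf_S_bound: assumes "\<And>n. \<bar>f n\<bar> \<le> D" shows "\<bar>\<Sum>n. \<gamma> ^ n * f n\<bar> \<le> D / (1 - \<gamma>)"
proof -
  have s: "summable (\<lambda>n. \<gamma> ^ n * D)" using \<gamma>0 \<gamma>1 by (intro summable_mult2 summable_geometric) auto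
  have n: "norm (\<gamma> ^ n * f n) \<le> \<gamma> ^ n * D" for n
    using assms[of n] \<gamma>0 by (auto simp: abs_mult intro!: mult_left_mono)
  have "norm (\<Sum>n. \<gamma> ^ n * f n) \<le> (\<Sum>n. \<gamma> ^ n * D)"
    using n s by (rule norm_suminf_le)
  also have "\<dots> = D / (1 - \<gamma>)"
    using \<gamma>0 \<gamma>1 by (subst suminf_mult2[symmetric]) (auto simp: suminf_geometric summable_geometric)
  finally show ?thesis by simp
qed

lemma S_bound: "\<bar>S x j\<bar> < real A"
  using suminf_S_bound[OF bounded] A_gt unfolding Sfun_def by (rule le_less_trans)

definition lip_const where "lip_const = L / (1 - \<gamma>)"

lemma lip_const_nonneg: "0 \<le> lip_const" using L_nonneg \<gamma>1 by (simp add: lip_const_def)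

text \<open>The n-th arguments differ by |x - y| / b^(n+1), and the weights \<gamma>^n are summable.
  Uniformity in j is the point: one digit sequence can be followed at two base points at
  once.\<close>

lemma S_lipschitz: "\<bar>S x j - S y j\<bar> \<le> lip_const * \<bar>x - y\<bar>"
proof -
  define d where "d n = \<phi> ((x + (\<Sum>k<Suc n. real (j k) * real b ^ k)) / real b ^ Suc n)
    - \<phi> ((y + (\<Sum>k<Suc n. real (j k) * real b ^ k)) / real b ^ Suc n)" for n
  have d: "\<bar>d n\<bar> \<le> L * \<bar>x - y\<bar>" for n
  proof -
    have "\<bar>d n\<bar> \<le> L * \<bar>(x + (\<Sum>k<Suc n. real (j k) * real b ^ k)) / real b ^ Suc n
       - (y + (\<Sum>k<Suc n. real (j k) * real b ^ k)) / real b ^ Suc n\<bar>"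
      unfolding d_def using lipschitz_onD[OF lip] by (simp add: dist_real_def)
    also have "\<dots> = L * (\<bar>x - y\<bar> / real b ^ Suc n)"
      using b_pos by (simp add: diff_divide_distrib[symmetric] abs_mult)
    also have "\<dots> \<le> L * \<bar>x - y\<bar>"
    proof (intro mult_left_mono L_nonneg)
      have "1 \<le> real b ^ Suc n" using b_pos by (intro one_le_power) simp
      then have "\<bar>x - y\<bar> / real b ^ Suc n \<le> \<bar>x - y\<bar> / 1" by (intro divide_left_mono) auto
      then show "\<bar>x - y\<bar> / real b ^ Suc n \<le> \<bar>x - y\<bar>" by simp
    qed
    finally show ?thesis .
  qed
  have "S x j - S y j = (\<Sum>n. \<gamma> ^ n * d n)"
    unfolding Sfun_def by (subst suminf_diff[OF summable_S summable_S]) (simp add: d_def right_diff_distrib)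
  then show ?thesis using suminf_S_bound[of d, OF d] by (simp add: lip_const_def)
qed

lemma S_measurable_pair [measurable]: "(\<lambda>p. S (fst p) (snd p)) \<in> borel_measurable (borel \<Otimes>\<^sub>M \<Omega>)"
  unfolding Sfun_def by measurable

lemma S_measurable [measurable (raw)]:
  assumes [measurable]: "f \<in> borel_measurable M" "g \<in> M \<rightarrow>\<^sub>M \<Omega>"
  shows "(\<lambda>x. S (f x) (g x)) \<in> borel_measurable M"
proof -
  have "(\<lambda>x. S (fst (f x, g x)) (snd (f x, g x))) \<in> borel_measurable M"
    by (rule measurable_compose[OF _ S_measurable_pair]) measurable
  then show ?thesis by simp
qed

text \<open>Prepending a digit shifts the series by one term: the argument with index n + 1 for x
  and the longer sequence is the argument with index n for (x + a) / b and j. Self-similarity of m_x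
  rests on this.\<close>

lemma S_case_nat: "S x (case_nat a j) = \<phi> ((x + real a) / real b) + \<gamma> * S ((x + real a) / real b) j"
proof -
  define f where "f n = \<gamma> ^ n * \<phi> ((x + (\<Sum>k<Suc n. real (case_nat a j k) * real b ^ k)) / real b ^ Suc n)" for n
  have s: "summable f" unfolding f_def by (rule summable_S)
  have f0: "f 0 = \<phi> ((x + real a) / real b)" by (simp add: f_def)
  have fS: "f (Suc n) = \<gamma> * (\<gamma> ^ n * \<phi> (((x + real a) / real b + (\<Sum>k<Suc n. real (j k) * real b ^ k)) / real b ^ Suc n))" for n
  proof -
    have "(\<Sum>k<Suc (Suc n). real (case_nat a j k) * real b ^ k) = real a + real b * (\<Sum>k<Suc n. real (j k) * real b ^ k)"
      by (subst sum.lessThan_Suc_shift) (simp add: sum_distrib_left mult.left_commute distrib_left)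
    moreover have "(x + (real a + real b * t)) / real b ^ Suc (Suc n) = ((x + real a) / real b + t) / real b ^ Suc n" for t
      using b_pos by (simp add: field_simps)
    ultimately show ?thesis by (simp add: f_def)
  qed
  have "S x (case_nat a j) = suminf f" by (simp add: Sfun_def f_def[abs_def])
  also have "\<dots> = f 0 + (\<Sum>n. f (Suc n))" using suminf_split_head[OF s] by simp
  also have "(\<Sum>n. f (Suc n)) = \<gamma> * S ((x + real a) / real b) j"
    unfolding fS Sfun_def by (rule suminf_mult[OF summable_S])
  finally show ?thesis by (simp add: f0)
qed

end

text \<open>The product measure is the law of a uniform first digit followed by an independent tail,
  so Fubini conditions on that digit.\<close>

lemma measure_seq_measure_step:
  assumes "0 < b" and E [measurable]: "E \<in> sets (seq_measure b)"
  shows "measure (seq_measure b) E = (\<Sum>a<b. measure (seq_measure b) ((\<lambda>j. case_nat a j) -` E)) / real b"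
proof -
  let ?M = "measure_pmf (pmf_of_set {0..<b})"
  interpret p: prob_space ?M by (rule prob_space_measure_pmf)
  interpret q: prob_space "seq_measure b" by (rule prob_space_seq_measure)
  interpret sequence_space ?M by unfold_locales
  have S: "seq_measure b = PiM UNIV (\<lambda>_::nat. ?M)" by (simp add: seq_measure_def)
  have m[measurable]: "(\<lambda>(s, \<omega>). case_nat s \<omega>) \<in> ?M \<Otimes>\<^sub>M seq_measure b \<rightarrow>\<^sub>M seq_measure b"
    unfolding S by measurable
  have m1[measurable]: "(\<lambda>\<omega>. case_nat a \<omega>) \<in> seq_measure b \<rightarrow>\<^sub>M seq_measure b" for a
    unfolding S by measurable
  have "emeasure (seq_measure b) E = emeasure (distr (?M \<Otimes>\<^sub>M seq_measure b) (seq_measure b) (\<lambda>(s, \<omega>). case_nat s \<omega>)) E"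
    using PiM_iter by (simp add: S)
  also have "\<dots> = emeasure (?M \<Otimes>\<^sub>M seq_measure b) ((\<lambda>(s, \<omega>). case_nat s \<omega>) -` E \<inter> space (?M \<Otimes>\<^sub>M seq_measure b))"
    by (rule emeasure_distr) measurable
  also have "\<dots> = (\<integral>\<^sup>+ a. emeasure (seq_measure b) (Pair a -` ((\<lambda>(s, \<omega>). case_nat s \<omega>) -` E \<inter> space (?M \<Otimes>\<^sub>M seq_measure b))) \<partial>?M)"
    by (rule q.emeasure_pair_measure_alt) measurable
  also have "\<dots> = (\<integral>\<^sup>+ a. ennreal (measure (seq_measure b) ((\<lambda>j. case_nat a j) -` E)) \<partial>?M)"
    by (intro nn_integral_cong) (auto simp: space_pair_measure q.emeasure_eq_measure vimage_def)
  also have "\<dots> = ennreal (\<integral>a. measure (seq_measure b) ((\<lambda>j. case_nat a j) -` E) \<partial>?M)"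
    by (rule nn_integral_eq_integral) (auto intro!: measure_pmf.integrable_const_bound[where B=1])
  also have "(\<integral>a. measure (seq_measure b) ((\<lambda>j. case_nat a j) -` E) \<partial>?M) =
     (\<Sum>a<b. measure (seq_measure b) ((\<lambda>j. case_nat a j) -` E)) / real b"
    using assms(1) by (subst integral_pmf_of_set) (auto simp: lessThan_atLeast0)
  finally show ?thesis
    by (subst (asm) q.emeasure_eq_measure, subst (asm) ennreal_inj) (auto intro!: sum_nonneg divide_nonneg_nonneg)
qed

section \<open>Words and self-similarity\<close>

lemma finite_words [simp]: "finite (words b n)"
  unfolding words_def using finite_lists_length_eq[of "{0..<b}" n] by (simp add: conj_commute)

lemma words_0 [simp]: "words b 0 = {[]}"
  by (auto simp: words_def)

lemma words_length: "w \<in> words b n \<Longrightarrow> length w = n"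
  by (simp add: words_def)

lemma sum_words_Suc: "(\<Sum>w\<in>words b (Suc n). f w) = (\<Sum>a<b. \<Sum>u\<in>words b n. f (a # u))"
proof -
  have "words b (Suc n) = (\<lambda>(a, u). a # u) ` ({..<b} \<times> words b n)"
    by (auto simp: words_def length_Suc_conv image_iff)
  then have "(\<Sum>w\<in>words b (Suc n). f w) = (\<Sum>x\<in>{..<b} \<times> words b n. f ((\<lambda>(a, u). a # u) x))"
    by (simp add: sum.reindex inj_on_def)
  then show ?thesis by (simp add: sum.cartesian_product split_def)
qed

lemma sum_words_add: "(\<Sum>w\<in>words b (n + p). f w) = (\<Sum>w\<in>words b n. \<Sum>u\<in>words b p. f (w @ u))"
  by (induction n arbitrary: f) (simp_all add: sum_words_Suc)

lemma card_words: "card (words b n) = b ^ n"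
  using card_lists_length_eq[of "{0..<b}" n] by (simp add: words_def conj_commute)

lemma word_map_Nil [simp]: "word_map b [] x = x"
  by (simp add: word_map_def)

lemma word_map_Cons: "0 < b \<Longrightarrow> word_map b (a # w) x = word_map b w ((x + real a) / real b)"
  unfolding word_map_def
  by (simp add: sum.lessThan_Suc_shift sum_distrib_left mult.left_commute del: sum.lessThan_Suc)
     (simp add: field_simps sum_distrib_left)

text \<open>The head of a word is its first digit and acts innermost, so extending a word on the
  right applies further maps to w(x). This identifies the base points of pieces at w(0) with points
  v(0) for longer words v.\<close>

lemma word_map_append: "0 < b \<Longrightarrow> word_map b (w @ u) x = word_map b u (word_map b w x)"
  by (induction w arbitrary: x) (simp_all add: word_map_Cons)

lemma word_map_diff: "word_map b w x - word_map b w y = (x - y) / real b ^ length w"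
  by (simp add: word_map_def diff_divide_distrib[symmetric])

lemma word_map_measurable [measurable]: "word_map b w \<in> borel_measurable borel"
  unfolding word_map_def by measurable

text \<open>Half-open, so that the b images under x \<mapsto> (x + a) / b tile it exactly; a density
  of \<open>lborel\<close>, so that almost-everywhere statements carry over.\<close>

definition unif :: "real measure" where
  "unif = density lborel (indicator {0..<1})"

lemma prob_space_unif: "prob_space unif"
  by (rule prob_spaceI) (simp add: unif_def emeasure_density)

lemma sets_unif [simp, measurable_cong]: "sets unif = sets borel" by (simp add: unif_def)

lemma space_unif [simp]: "space unif = UNIV" by (simp add: unif_def)

lemma integral_unif:
  fixes f :: "real \<Rightarrow> real"
  assumes [measurable]: "f \<in> borel_measurable borel"
  shows "(\<integral>x. f x \<partial>unif) = (\<integral>x. indicator {0..<1::real} x * f x \<partial>lborel)"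
proof -
  have "unif = density lborel (\<lambda>x. ennreal (indicator {0..<1} x))"
    by (simp add: unif_def ennreal_indicator)
  then have "(\<integral>x. f x \<partial>unif) = (\<integral>x. f x \<partial>density lborel (\<lambda>x. ennreal (indicator {0..<1} x)))"
    by (rule arg_cong)
  also have "\<dots> = (\<integral>x. indicator {0..<1::real} x * f x \<partial>lborel)"
    by (subst integral_density) auto
  finally show ?thesis .
qed

text \<open>Lebesgue measure on [0, 1) is stationary under x \<mapsto> (x + a) / b with a random
  digit a: split [0, 1) into the intervals \<open>I a\<close> and substitute affinely on each. The
  bound \<open>B\<close> supplies integrability.\<close>

lemma integral_unif_step:
  assumes b: "0 < b" and [measurable]: "f \<in> borel_measurable borel" and bd: "\<And>x. \<bar>f x\<bar> \<le> B"
  shows "(\<integral>x. f x \<partial>unif) = (\<Sum>a<b. \<integral>x. f ((x + real a) / real b) \<partial>unif) / real b"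
proof -
  define I where "I a = {real a / real b ..< (real a + 1) / real b}" for a
  have I[measurable]: "I a \<in> sets borel" for a by (simp add: I_def)
  have ind: "indicator {0..<1::real} x = (\<Sum>a<b. indicator (I a) x :: real)" for x
  proof (cases "x \<in> {0..<1}")
    case True
    define c where "c = nat \<lfloor>x * real b\<rfloor>"
    have c: "real c \<le> x * real b" "x * real b < real c + 1"
      using True b by (auto simp: c_def)
    have "x * real b < real b" using True b by simp
    then have "c < b" using c by linarith
    have "x \<in> I a \<longleftrightarrow> a = c" for a
    proof -
      have "x \<in> I a \<longleftrightarrow> real a \<le> x * real b \<and> x * real b < real a + 1"
        using b by (simp add: I_def field_simps)
      also have "\<dots> \<longleftrightarrow> a = c" using c by auto
      finally show ?thesis .
    qed
    then have "(\<Sum>a<b. indicator (I a) x :: real) = (\<Sum>a<b. if a = c then 1 else 0)"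
      by (intro sum.cong) (auto simp: indicator_def)
    then show ?thesis using True \<open>c < b\<close> by simp
  next
    case False
    have "x \<notin> I a" if "a < b" for a
    proof
      assume "x \<in> I a"
      then have "0 \<le> real a / real b" "x < (real a + 1) / real b" "real a / real b \<le> x" by (auto simp: I_def)
      moreover have "(real a + 1) / real b \<le> 1" using that b by simp
      ultimately have "0 \<le> x" "x < 1" by linarith+
      then show False using False by simp
    qed
    then have "(\<Sum>a<b. indicator (I a) x :: real) = (\<Sum>a<b. 0)" by (intro sum.cong) auto
    then show ?thesis using False by simp
  qed
  have int: "integrable lborel (\<lambda>x. indicator (I a) x * f x)" for a
  proof (rule Bochner_Integration.integrable_bound)
    show "integrable lborel (\<lambda>x. indicator (I a) x * B)"
      using b by (intro integrable_mult_left) (auto simp: I_def divide_right_mono)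
    have "0 \<le> B" using bd[of 0] by simp
    then show "AE x in lborel. norm (indicator (I a) x * f x) \<le> norm (indicator (I a) x * B)"
      using bd by (auto simp: indicator_def)
  qed measurable
  have "(\<integral>x. f x \<partial>unif) = (\<integral>x. (\<Sum>a<b. indicator (I a) x * f x) \<partial>lborel)"
    by (simp add: integral_unif ind sum_distrib_right)
  also have "\<dots> = (\<Sum>a<b. \<integral>x. indicator (I a) x * f x \<partial>lborel)"
    using int by (rule Bochner_Integration.integral_sum)
  also have "\<dots> = (\<Sum>a<b. (\<integral>x. f ((x + real a) / real b) \<partial>unif) / real b)"
  proof (rule sum.cong)
    fix a
    have "(\<integral>x. indicator (I a) x * f x \<partial>lborel)
      = \<bar>1 / real b\<bar> *\<^sub>R (\<integral>x. indicator (I a) (real a / real b + 1 / real b * x) * f (real a / real b + 1 / real b * x) \<partial>lborel)"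
      using b by (intro lborel_integral_real_affine) simp
    also have "(\<lambda>x. indicator (I a) (real a / real b + 1 / real b * x) * f (real a / real b + 1 / real b * x))
      = (\<lambda>x. indicator {0..<1} x * f ((x + real a) / real b))"
      using b by (auto simp: I_def indicator_def fun_eq_iff add_divide_distrib add.commute divide_strict_right_mono)
        (simp_all add: add_divide_distrib[symmetric] divide_simps split: if_splits)
    finally show "(\<integral>x. indicator (I a) x * f x \<partial>lborel) = (\<integral>x. f ((x + real a) / real b) \<partial>unif) / real b"
      by (simp add: integral_unif)
  qed simp
  finally show ?thesis by (simp add: sum_divide_distrib)
qed

lemma integral_unif_words:
  assumes b: "0 < b" and "f \<in> borel_measurable borel" and "\<And>x. \<bar>f x\<bar> \<le> B"
  shows "(\<integral>x. f x \<partial>unif) = (\<Sum>w\<in>words b n. \<integral>x. f (word_map b w x) \<partial>unif) / real b ^ n"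
proof (induction n)
  case (Suc n)
  have "(\<Sum>w\<in>words b (Suc n). \<integral>x. f (word_map b w x) \<partial>unif)
     = (\<Sum>u\<in>words b n. \<Sum>a<b. \<integral>x. f (word_map b u ((x + real a) / real b)) \<partial>unif)"
    unfolding sum_words_Suc by (subst sum.swap) (simp add: word_map_Cons b)
  \<comment> \<open>The digit a acts innermost, so for fixed u the sum over a is the one-digit case
    for f composed with \<open>word_map b u\<close>.\<close>
  also have "\<dots> = (\<Sum>u\<in>words b n. real b * (\<integral>x. f (word_map b u x) \<partial>unif))"
  proof (rule sum.cong)
    fix u
    have [measurable]: "f \<in> borel_measurable borel" by fact
    show "(\<Sum>a<b. \<integral>x. f (word_map b u ((x + real a) / real b)) \<partial>unif) = real b * (\<integral>x. f (word_map b u x) \<partial>unif)"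
      using b assms(3) by (subst (2) integral_unif_step[where B=B and b=b]) auto
  qed simp
  finally show ?case
    using Suc b by (simp add: sum_distrib_left[symmetric])
qed simp

context weierstrass
begin

lemma sets_mu [simp, measurable_cong]: "sets (\<mu> x) = sets borel" by (simp add: mx_def)

lemma measure_mu: "E \<in> sets borel \<Longrightarrow> measure (\<mu> x) E = prob {j. S x j \<in> E}"
  unfolding mx_def by (subst measure_distr) (auto simp: vimage_def)

lemma prob_space_mu: "prob_space (\<mu> x)"
  unfolding mx_def by (rule prob_space_distr) measurable

text \<open>The first \<open>length u\<close> terms of the series S when the digits start with u.
  Iterating \<open>S_case_nat\<close>, the whole sum is this plus \<gamma>^\<open>length u\<close>
  times S at u(x).\<close>

primrec offset :: "nat list \<Rightarrow> real \<Rightarrow> real" where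
  "offset [] x = 0"
| "offset (a # u) x = \<phi> ((x + real a) / real b) + \<gamma> * offset u ((x + real a) / real b)"

text \<open>The conditional law of S x given that the digits start with u: an affine copy of the
  measure at u(x).\<close>

definition piece :: "nat list \<Rightarrow> real \<Rightarrow> real measure" where
  "piece u x = distr \<Omega> borel (\<lambda>j. offset u x + \<gamma> ^ length u * S (word_map b u x) j)"

lemma sets_piece [simp, measurable_cong]: "sets (piece u x) = sets borel" by (simp add: piece_def)

lemma prob_space_piece: "prob_space (piece u x)"
  unfolding piece_def by (rule prob_space_distr) measurable

lemma measure_piece:
  "E \<in> sets borel \<Longrightarrow> measure (piece u x) E = prob {j. offset u x + \<gamma> ^ length u * S (word_map b u x) j \<in> E}"
  unfolding piece_def by (subst measure_distr) (auto simp: vimage_def)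

text \<open>Conditioning on the first p digits. Both x and E vary in the induction, since removing a
  digit moves the base point and pulls E back under an affine map.\<close>

lemma measure_mu_pieces:
  assumes "E \<in> sets borel"
  shows "measure (\<mu> x) E = (\<Sum>u\<in>words b p. measure (piece u x) E) / real b ^ p"
  using assms
proof (induction p arbitrary: x E)
  case 0
  then show ?case by (simp add: measure_mu measure_piece)
next
  case (Suc p)
  note [measurable] = \<open>E \<in> sets borel\<close>
  define y where "y a = (x + real a) / real b" for a
  define E' where "E' a = (\<lambda>t. \<phi> (y a) + \<gamma> * t) -` E" for a
  have "(\<lambda>t. \<phi> (y a) + \<gamma> * t) -` E \<inter> space borel \<in> sets borel" for a
    by measurable
  then have E'[measurable]: "E' a \<in> sets borel" for a by (simp add: E'_def)
  have "measure (\<mu> x) E = prob {j. S x j \<in> E}" by (simp add: measure_mu)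
  also have "\<dots> = (\<Sum>a<b. prob ((\<lambda>j. case_nat a j) -` {j. S x j \<in> E})) / real b"
  proof (rule measure_seq_measure_step)
    have "{j \<in> space \<Omega>. S x j \<in> E} \<in> sets \<Omega>" by measurable
    then show "{j. S x j \<in> E} \<in> sets \<Omega>" by simp
  qed (use b_pos in simp)
  also have "\<dots> = (\<Sum>a<b. measure (\<mu> (y a)) (E' a)) / real b"
    by (simp add: measure_mu E'_def y_def S_case_nat vimage_def)
  also have "\<dots> = (\<Sum>a<b. (\<Sum>u\<in>words b p. measure (piece u (y a)) (E' a)) / real b ^ p) / real b"
    using Suc.IH[OF E'] by simp
  also have "\<dots> = (\<Sum>a<b. \<Sum>u\<in>words b p. measure (piece (a # u) x) E) / real b ^ Suc p"
  proof -
    have "measure (piece u (y a)) (E' a) = measure (piece (a # u) x) E" for a u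
      using b_pos E'[of a] \<open>E \<in> sets borel\<close>
      by (simp add: measure_piece word_map_Cons, simp add: E'_def y_def distrib_left mult.assoc add.assoc)
    then show ?thesis by (simp add: sum_divide_distrib mult.commute)
  qed
  finally show ?case by (simp add: sum_words_Suc)
qed

end

section \<open>Mass of balls along typical points\<close>

context weierstrass
begin

text \<open>The m_z-mass of the ball of radius r about S z j. Working with digit sequences instead
  of points of the line couples the measures at different z.\<close>

definition ball_prob :: "real \<Rightarrow> real \<Rightarrow> (nat \<Rightarrow> nat) \<Rightarrow> real" where
  "ball_prob z r j = prob {j'. \<bar>S z j' - S z j\<bar> < r}"

definition heavy_prob :: "real \<Rightarrow> real \<Rightarrow> real \<Rightarrow> real" where
  "heavy_prob r t z = prob {j. t < ball_prob z r j}"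

definition light_prob :: "real \<Rightarrow> real \<Rightarrow> real \<Rightarrow> real" where
  "light_prob r t z = prob {j. ball_prob z r j < t}"

text \<open>Joint measurability is required because these probabilities are later integrated over
  the base point.\<close>

lemma prob_measurable_pair:
  assumes P: "Measurable.pred (M \<Otimes>\<^sub>M \<Omega>) (\<lambda>p. P (fst p) (snd p))"
  shows "(\<lambda>x. prob {j. P x j}) \<in> borel_measurable M"
proof -
  note [measurable] = P
  have 1: "(\<lambda>x. \<integral>j. (if P x j then 1 else 0 :: real) \<partial>\<Omega>) \<in> borel_measurable M"
    by (rule borel_measurable_lebesgue_integral) (simp add: split_beta')
  have "prob {j. P x j} = (\<integral>j. (if P x j then 1 else 0) \<partial>\<Omega>)" if "x \<in> space M" for x
  proof -
    have "{j. P x j} = {j \<in> space \<Omega>. P (fst (x, j)) (snd (x, j))}" by simp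
    also have "\<dots> \<in> sets \<Omega>"
      using measurable_compose[OF measurable_Pair1'[OF that] P] by (simp add: pred_def)
    finally have "{j. P x j} \<in> sets \<Omega>" .
    moreover have "(\<lambda>j. if P x j then 1 else 0 :: real) = indicator {j. P x j}" by (auto simp: indicator_def)
    ultimately show ?thesis by simp
  qed
  then show ?thesis using 1 by (subst measurable_cong) auto
qed

lemma ball_prob_measurable_pair: "(\<lambda>p. ball_prob (fst p) r (snd p)) \<in> borel_measurable (borel \<Otimes>\<^sub>M \<Omega>)"
  unfolding ball_prob_def by (rule prob_measurable_pair) measurable

lemma ball_prob_measurable [measurable]: "ball_prob z r \<in> borel_measurable \<Omega>"
proof -
  have "(\<lambda>j. ball_prob (fst (z, j)) r (snd (z, j))) \<in> borel_measurable \<Omega>"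
    by (rule measurable_compose[OF _ ball_prob_measurable_pair]) measurable
  then show ?thesis by simp
qed

lemma heavy_prob_measurable [measurable]: "heavy_prob r t \<in> borel_measurable borel"
  unfolding heavy_prob_def[abs_def] using ball_prob_measurable_pair by (intro prob_measurable_pair) measurable

lemma light_prob_measurable [measurable]: "light_prob r t \<in> borel_measurable borel"
  unfolding light_prob_def[abs_def] using ball_prob_measurable_pair by (intro prob_measurable_pair) measurable

lemma sets_Collect_S:
  assumes "Measurable.pred borel Q" shows "{j. Q (S x j)} \<in> sets \<Omega>"
proof -
  have "{j \<in> space \<Omega>. Q (S x j)} \<in> sets \<Omega>"
    using assms by measurable
  then show ?thesis by simp
qed

text \<open>Moving the base point displaces the centre and every other point by at most s each, so
  the radius grows by 2 s.\<close>

lemma ball_prob_perturb: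
  assumes "lip_const * \<bar>x - z\<bar> \<le> s"
  shows "ball_prob x r j \<le> ball_prob z (r + 2 * s) j"
  unfolding ball_prob_def
proof (rule finite_measure_mono)
  show "{j'. \<bar>S x j' - S x j\<bar> < r} \<subseteq> {j'. \<bar>S z j' - S z j\<bar> < r + 2 * s}"
  proof safe
    fix j' assume "\<bar>S x j' - S x j\<bar> < r"
    moreover have "\<bar>S x j - S z j\<bar> \<le> s" "\<bar>S x j' - S z j'\<bar> \<le> s"
      using S_lipschitz[of x j z] S_lipschitz[of x j' z] assms by linarith+
    ultimately show "\<bar>S z j' - S z j\<bar> < r + 2 * s" by linarith
  qed
  show "{j'. \<bar>S z j' - S z j\<bar> < r + 2 * s} \<in> events"
    by (rule sets_Collect_S) measurable
qed

lemma sets_Collect_ball_prob: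
  assumes "Measurable.pred borel Q" shows "{j. Q (ball_prob x r j)} \<in> sets \<Omega>"
proof -
  have "{j \<in> space \<Omega>. Q (ball_prob x r j)} \<in> sets \<Omega>"
    using assms by measurable
  then show ?thesis by simp
qed

lemma heavy_prob_perturb:
  assumes "lip_const * \<bar>x - z\<bar> \<le> s"
  shows "heavy_prob r t x \<le> heavy_prob (r + 2 * s) t z"
  unfolding heavy_prob_def
  by (intro finite_measure_mono sets_Collect_ball_prob) (auto intro: less_le_trans[OF _ ball_prob_perturb[OF assms]])

text \<open>Here the radius shrinks on passing from x to z: a larger ball at x that is light
  contains, up to the displacement, the smaller ball at z.\<close>

lemma light_prob_perturb:
  assumes "lip_const * \<bar>x - z\<bar> \<le> s"
  shows "light_prob (r + 2 * s) t x \<le> light_prob r t z"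
proof -
  have "lip_const * \<bar>z - x\<bar> \<le> s" using assms by (simp add: abs_minus_commute)
  then show ?thesis
    unfolding light_prob_def
    by (intro finite_measure_mono sets_Collect_ball_prob) (auto intro: le_less_trans[OF ball_prob_perturb])
qed

text \<open>Cut the line into countably many intervals of length r. Almost surely S z j avoids the
  null ones, and the interval it lies in is contained in its ball. Positivity is what permits
  comparing ball masses through their logarithms.\<close>

lemma AE_ball_prob_pos:
  assumes "0 < r" shows "AE j in \<Omega>. 0 < ball_prob z r j"
proof -
  define I where "I d = {j. \<lfloor>S z j / r\<rfloor> = (d::int)}" for d
  have I: "I d \<in> sets \<Omega>" for d unfolding I_def by (rule sets_Collect_S) measurable
  have "AE j in \<Omega>. prob (I d) = 0 \<longrightarrow> j \<notin> I d" for d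
    using I[of d] by (cases "prob (I d) = 0") (auto simp: prob_eq_0)
  then have "AE j in \<Omega>. \<forall>d. prob (I d) = 0 \<longrightarrow> j \<notin> I d"
    by (simp add: AE_all_countable)
  then show ?thesis
  proof (rule AE_mp, intro AE_I2 impI)
    fix j assume *: "\<forall>d. prob (I d) = 0 \<longrightarrow> j \<notin> I d"
    define d where "d = \<lfloor>S z j / r\<rfloor>"
    have "prob (I d) \<noteq> 0" using * by (auto simp: I_def d_def)
    moreover have "prob (I d) \<le> ball_prob z r j"
      unfolding ball_prob_def
    proof (rule finite_measure_mono)
      show "I d \<subseteq> {j'. \<bar>S z j' - S z j\<bar> < r}"
      proof
        fix j' assume "j' \<in> I d"
        then have "\<lfloor>S z j' / r\<rfloor> = \<lfloor>S z j / r\<rfloor>" by (simp add: I_def d_def)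
        then have "\<bar>S z j' / r - S z j / r\<bar> < 1" by linarith
        then have "\<bar>S z j' - S z j\<bar> / r < 1" using assms by (simp add: diff_divide_distrib[symmetric])
        then show "j' \<in> {j'. \<bar>S z j' - S z j\<bar> < r}" using assms by simp
      qed
      show "{j'. \<bar>S z j' - S z j\<bar> < r} \<in> events" by (rule sets_Collect_S) measurable
    qed
    ultimately show "0 < ball_prob z r j" using measure_nonneg[of \<Omega> "I d"] by linarith
  qed
qed

text \<open>Along radii c b^-n the denominator ln r is asymptotic to -n ln b, so normalising by n
  makes the constant c disappear.\<close>

lemma AE_ball_prob_limit:
  assumes "exact_dimensional (\<mu> z) \<alpha>" "0 < c"
  shows "AE j in \<Omega>. (\<lambda>n. ln (ball_prob z (c / real b ^ n) j) / real n) \<longlonglongrightarrow> - \<alpha> * ln (real b)"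
proof -
  have ball_prob: "ball_prob z r j = measure (\<mu> z) (ball (S z j) r)" for r j
    by (simp add: measure_mu ball_prob_def dist_real_def abs_minus_commute)
  have "S z \<in> \<Omega> \<rightarrow>\<^sub>M borel" by measurable
  from AE_distrD[OF this] assms(1)
  have "AE j in \<Omega>. ((\<lambda>r. ln (ball_prob z r j) / ln r) \<longlongrightarrow> \<alpha>) (at_right 0)"
    unfolding ball_prob exact_dimensional_def mx_def by blast
  then show ?thesis
  proof (rule AE_mp, intro AE_I2 impI)
    fix j assume lim: "((\<lambda>r. ln (ball_prob z r j) / ln r) \<longlongrightarrow> \<alpha>) (at_right 0)"
    define r where "r n = c / real b ^ n" for n
    have r0: "r \<longlonglongrightarrow> 0"
    proof -
      have "(\<lambda>n. c * (1 / real b) ^ n) \<longlonglongrightarrow> c * 0"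
        using b_pos by (intro tendsto_mult tendsto_const LIMSEQ_realpow_zero) auto
      then show ?thesis by (simp add: r_def[abs_def] power_divide)
    qed
    have rpos: "0 < r n" for n using assms(2) b_pos by (simp add: r_def)
    have "r n \<noteq> 0" for n using rpos[of n] by simp
    then have "filterlim r (at_right 0) sequentially"
      using r0 rpos by (auto simp: filterlim_at)
    then have 1: "(\<lambda>n. ln (ball_prob z (r n) j) / ln (r n)) \<longlonglongrightarrow> \<alpha>"
      by (rule filterlim_compose[OF lim])
    have "(\<lambda>n. ln c * (1 / real n) - ln (real b)) \<longlonglongrightarrow> ln c * 0 - ln (real b)"
      by (intro tendsto_intros lim_1_over_n)
    moreover have "\<forall>\<^sub>F n in sequentially. ln c * (1 / real n) - ln (real b) = ln (r n) / real n"
      using eventually_gt_at_top[of 0]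
    proof eventually_elim
      case (elim n)
      have "ln (r n) = ln c - real n * ln (real b)"
        using assms(2) b_pos by (simp add: r_def ln_div ln_realpow)
      then show ?case using elim by (simp add: field_simps)
    qed
    ultimately have 2: "(\<lambda>n. ln (r n) / real n) \<longlonglongrightarrow> - ln (real b)"
      by (simp add: tendsto_cong)
    \<comment> \<open>Below radius 1 the logarithm is nonzero, so the factor ln (r n)
      cancels.\<close>
    have "\<forall>\<^sub>F n in sequentially. r n < 1" using order_tendstoD(2)[OF r0, of 1] by simp
    then have "\<forall>\<^sub>F n in sequentially. ln (ball_prob z (r n) j) / ln (r n) * (ln (r n) / real n) = ln (ball_prob z (r n) j) / real n"
    proof eventually_elim
      case (elim n)
      then have "ln (r n) < 0" using rpos[of n] by (simp add: ln_less_zero)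
      then show ?case by simp
    qed
    from tendsto_cong[OF this] tendsto_mult[OF 1 2]
    show "(\<lambda>n. ln (ball_prob z (c / real b ^ n) j) / real n) \<longlonglongrightarrow> - \<alpha> * ln (real b)"
      by (simp add: r_def)
  qed
qed

lemma prob_tendsto_0:
  assumes E: "\<And>n. E n \<in> sets \<Omega>" and ae: "AE j in \<Omega>. \<forall>\<^sub>F n in sequentially. j \<notin> E n"
  shows "(\<lambda>n::nat. prob (E n)) \<longlonglongrightarrow> 0"
proof -
  have "(\<lambda>n. \<integral>j. indicator (E n) j \<partial>\<Omega>) \<longlonglongrightarrow> (\<integral>j. (0::real) \<partial>\<Omega>)"
  proof (rule integral_dominated_convergence[where w="\<lambda>_. 1"])
    show "AE j in \<Omega>. (\<lambda>n. indicator (E n) j :: real) \<longlonglongrightarrow> 0"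
      using ae
    proof (rule AE_mp, intro AE_I2 impI)
      fix j assume "\<forall>\<^sub>F n in sequentially. j \<notin> E n"
      then have "\<forall>\<^sub>F n in sequentially. indicator (E n) j = (0::real)" by eventually_elim simp
      then show "(\<lambda>n. indicator (E n) j :: real) \<longlonglongrightarrow> 0" by (rule tendsto_eventually)
    qed
  qed (use E in \<open>auto simp: indicator_def\<close>)
  then show ?thesis using E by simp
qed

text \<open>A typical ball of radius c b^-n has mass about b^(-n \<alpha>), which is below b^(-n
  \<tau>) for \<tau> < \<alpha>. The alternative \<tau> = 0 covers an \<alpha> too small to subtract
  from: the threshold is then 1, which no mass exceeds.\<close>

lemma heavy_prob_tendsto:
  assumes ed: "exact_dimensional (\<mu> z) \<alpha>" and "0 < c" "\<tau> < \<alpha> \<or> \<tau> = 0"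
  shows "(\<lambda>n. heavy_prob (c / real b ^ n) (real b powr - (real n * \<tau>)) z) \<longlonglongrightarrow> 0"
proof (cases "\<tau> = 0")
  case True
  have "ball_prob z r j \<le> 1" for r j by (simp add: ball_prob_def)
  then have "heavy_prob (c / real b ^ n) (real b powr - (real n * \<tau>)) z = 0" for n
    using True b_pos by (simp add: heavy_prob_def not_less[symmetric])
  then show ?thesis by simp
next
  case False
  then have \<tau>: "\<tau> < \<alpha>" using assms by simp
  have "AE j in \<Omega>. \<forall>n. 0 < ball_prob z (c / real b ^ n) j"
    using AE_ball_prob_pos \<open>0 < c\<close> b_pos by (simp add: AE_all_countable)
  with AE_ball_prob_limit[OF ed \<open>0 < c\<close>]
  have "AE j in \<Omega>. \<forall>\<^sub>F n in sequentially. j \<notin> {j. real b powr - (real n * \<tau>) < ball_prob z (c / real b ^ n) j}"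
  proof eventually_elim
    case (elim j)
    have "- \<alpha> * ln (real b) < - \<tau> * ln (real b)" using \<tau> b_pos by simp
    from order_tendstoD(2)[OF elim(1) this] eventually_gt_at_top[of 0] show ?case
    proof eventually_elim
      case (elim n)
      then have "ln (ball_prob z (c / real b ^ n) j) < - (real n * \<tau>) * ln (real b)"
        by (simp add: field_simps)
      also have "\<dots> = ln (real b powr - (real n * \<tau>))" using b_pos by (simp add: ln_powr)
      finally have "ball_prob z (c / real b ^ n) j < real b powr - (real n * \<tau>)"
        using \<open>\<forall>n. 0 < ball_prob z (c / real b ^ n) j\<close> b_pos by (subst (asm) ln_less_cancel_iff) auto
      then show ?case by simp
    qed
  qed
  then show ?thesis unfolding heavy_prob_def
    by (intro prob_tendsto_0 sets_Collect_ball_prob) auto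
qed

lemma light_prob_tendsto:
  assumes ed: "exact_dimensional (\<mu> z) \<alpha>" and "0 < c" "\<alpha> < \<tau>"
  shows "(\<lambda>n. light_prob (c / real b ^ n) (real b powr - (real n * \<tau>)) z) \<longlonglongrightarrow> 0"
proof -
  have "AE j in \<Omega>. \<forall>n. 0 < ball_prob z (c / real b ^ n) j"
    using AE_ball_prob_pos \<open>0 < c\<close> b_pos by (simp add: AE_all_countable)
  with AE_ball_prob_limit[OF ed \<open>0 < c\<close>]
  have "AE j in \<Omega>. \<forall>\<^sub>F n in sequentially. j \<notin> {j. ball_prob z (c / real b ^ n) j < real b powr - (real n * \<tau>)}"
  proof eventually_elim
    case (elim j)
    have "- \<tau> * ln (real b) < - \<alpha> * ln (real b)" using \<open>\<alpha> < \<tau>\<close> b_pos by simp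
    from order_tendstoD(1)[OF elim(1) this] eventually_gt_at_top[of 0] show ?case
    proof eventually_elim
      case (elim n)
      have "ln (real b powr - (real n * \<tau>)) = - (real n * \<tau>) * ln (real b)" using b_pos by (simp add: ln_powr)
      also have "\<dots> < ln (ball_prob z (c / real b ^ n) j)"
        using elim by (simp add: field_simps)
      finally have "real b powr - (real n * \<tau>) < ball_prob z (c / real b ^ n) j"
        using \<open>\<forall>n. 0 < ball_prob z (c / real b ^ n) j\<close> b_pos by (subst (asm) ln_less_cancel_iff) auto
      then show ?case by simp
    qed
  qed
  then show ?thesis unfolding light_prob_def
    by (intro prob_tendsto_0 sets_Collect_ball_prob) auto
qed

section \<open>Passing from almost every base point to averages over words\<close>

lemma integral_unif_tendsto_0:
  fixes g :: "nat \<Rightarrow> real \<Rightarrow> real"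
  assumes "\<And>n. g n \<in> borel_measurable borel" "\<And>n x. 0 \<le> g n x" "\<And>n x. g n x \<le> 1"
    and "AE z in lborel. z \<in> {0..1} \<longrightarrow> (\<lambda>n. g n z) \<longlonglongrightarrow> 0"
  shows "(\<lambda>n. \<integral>z. g n z \<partial>unif) \<longlonglongrightarrow> 0"
proof -
  interpret U: prob_space unif by (rule prob_space_unif)
  have "(\<lambda>n. \<integral>z. g n z \<partial>unif) \<longlonglongrightarrow> (\<integral>z. (0::real) \<partial>unif)"
  proof (rule integral_dominated_convergence[where w="\<lambda>_. 1"])
    have "AE z in lborel. 0 < (indicator {0..<1} z :: ennreal) \<longrightarrow> (\<lambda>n. g n z) \<longlonglongrightarrow> 0"
      using assms(4) by eventually_elim (auto simp: indicator_def split: if_splits)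
    then show "AE z in unif. (\<lambda>n. g n z) \<longlonglongrightarrow> 0"
      unfolding unif_def by (subst AE_density) auto
    show "g n \<in> borel_measurable unif" for n using assms(1)[of n] by measurable
  qed (use assms(2,3) in auto)
  then show ?thesis by simp
qed

text \<open>Points in the same cylinder are close, so a perturbation bound turns the discrete
  average over words into a Lebesgue integral.\<close>

lemma sum_words_le_integral:
  fixes g g' :: "real \<Rightarrow> real"
  assumes [measurable]: "g' \<in> borel_measurable borel" and bd: "\<And>x. \<bar>g' x\<bar> \<le> 1"
    and le: "\<And>x z. \<bar>x - z\<bar> \<le> 1 / real b ^ n \<Longrightarrow> g x \<le> g' z"
  shows "(\<Sum>w\<in>words b n. g (word_map b w 0)) / real b ^ n \<le> (\<integral>z. g' z \<partial>unif)"
proof -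
  interpret U: prob_space unif by (rule prob_space_unif)
  have int: "integrable unif (\<lambda>t. g' (word_map b w t))" for w
    using bd by (intro U.integrable_const_bound[where B=1]) auto
  have "g (word_map b w 0) \<le> (\<integral>t. g' (word_map b w t) \<partial>unif)" if w: "w \<in> words b n" for w
  proof -
    have "AE t in unif. g (word_map b w 0) \<le> g' (word_map b w t)"
      unfolding unif_def
    proof (subst AE_density, simp, intro AE_I2 impI)
      fix t :: real assume "0 < (indicator {0..<1} t :: ennreal)"
      then have "t \<in> {0..<1}" by (cases "t \<in> {0..<1}") auto
      then show "g (word_map b w 0) \<le> g' (word_map b w t)"
        using words_length[OF w] b_pos
        by (intro le) (simp add: word_map_diff divide_right_mono)
    qed
    then have "(\<integral>t. g (word_map b w 0) \<partial>unif) \<le> (\<integral>t. g' (word_map b w t) \<partial>unif)"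
      using int by (intro integral_mono_AE) auto
    then show ?thesis using U.prob_space by simp
  qed
  then show ?thesis
    using b_pos bd by (subst integral_unif_words[where b=b and n=n and B=1]) (auto intro!: divide_right_mono sum_mono)
qed

end

section \<open>Entropy along the b-adic partitions\<close>

lemma mult_ln_ratio_le:
  fixes s t :: real
  assumes "0 \<le> t" "0 \<le> s" "0 < t \<Longrightarrow> 0 < s"
  shows "t * ln (s / t) \<le> s - t"
proof (cases "t = 0")
  case False
  then have "0 < t" "0 < s" using assms by auto
  then have "t * ln (s / t) \<le> t * (s / t - 1)"
    by (intro mult_left_mono ln_le_minus_one) auto
  also have "\<dots> = s - t" using \<open>0 < t\<close> by (simp add: field_simps)
  finally show ?thesis .
qed (use assms in simp)

text \<open>The relative entropy of p with respect to q is nonnegative, also when the total of q is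
  below that of p.\<close>

lemma gibbs_inequality:
  fixes p q :: "'a \<Rightarrow> real"
  assumes "\<And>x. x \<in> X \<Longrightarrow> 0 \<le> p x" "\<And>x. x \<in> X \<Longrightarrow> 0 < q x"
    and "sum q X \<le> sum p X" "1 < B"
  shows "(\<Sum>x\<in>X. - p x * log B (p x)) \<le> (\<Sum>x\<in>X. - p x * log B (q x))"
proof -
  have "p x * ln (q x / p x) = p x * ln (q x) - p x * ln (p x)" if "x \<in> X" for x
    using assms(1,2)[OF that] by (cases "p x = 0") (auto simp: ln_div right_diff_distrib)
  then have "(\<Sum>x\<in>X. p x * ln (q x) - p x * ln (p x)) = (\<Sum>x\<in>X. p x * ln (q x / p x))"
    by simp
  also have "\<dots> \<le> (\<Sum>x\<in>X. q x - p x)"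
    using assms(1,2) by (intro sum_mono mult_ln_ratio_le) (auto simp: less_imp_le)
  also have "\<dots> \<le> 0" using assms(3) by (simp add: sum_subtractf)
  finally have "(\<Sum>x\<in>X. p x * ln (q x)) \<le> (\<Sum>x\<in>X. p x * ln (p x))"
    by (simp add: sum_subtractf)
  then have "(\<Sum>x\<in>X. p x * ln (q x)) / ln B \<le> (\<Sum>x\<in>X. p x * ln (p x)) / ln B"
    using assms(4) by (intro divide_right_mono) auto
  then show ?thesis by (simp add: log_def sum_negf sum_divide_distrib)
qed

text \<open>Expresses concavity of (s, t) \<mapsto> t log (s / t). It will show that conditional
  entropy cannot decrease when measures are averaged.\<close>

lemma log_sum_inequality:
  fixes s t :: "'a \<Rightarrow> real"
  assumes "finite U" and t: "\<And>u. u \<in> U \<Longrightarrow> 0 \<le> t u" and s: "\<And>u. u \<in> U \<Longrightarrow> t u \<le> s u" and B: "1 < B"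
  shows "(\<Sum>u\<in>U. t u * log B (s u / t u)) \<le> sum t U * log B (sum s U / sum t U)"
proof (cases "sum t U = 0")
  case True
  then have "\<forall>u\<in>U. t u = 0" using assms by (simp add: sum_nonneg_eq_0_iff)
  then show ?thesis using True by simp
next
  case False
  define T where "T = sum t U"
  define Z where "Z = sum s U"
  have T: "0 < T" using False t by (simp add: T_def sum_nonneg order_less_le)
  have "T \<le> Z" unfolding T_def Z_def using s by (rule sum_mono)
  then have Z: "0 < Z" using T by simp
  \<comment> \<open>Compare with the rescaled weights s u T / Z, which have the same total as t; the
    right-hand sides therefore sum to 0.\<close>
  have "t u * ln (s u / t u) - t u * ln (Z / T) \<le> s u * T / Z - t u" if u: "u \<in> U" for u
  proof (cases "t u = 0")
    case True
    have "0 \<le> s u" using t[OF u] s[OF u] by simp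
    then show ?thesis using True T Z by simp
  next
    case False
    then have tu: "0 < t u" "0 < s u" using t[OF u] s[OF u] by auto
    have "t u * ln (s u / t u) - t u * ln (Z / T) = t u * ln ((s u * T / Z) / t u)"
      using tu T Z by (simp add: ln_div ln_mult algebra_simps)
    also have "\<dots> \<le> s u * T / Z - t u"
      using tu T Z by (intro mult_ln_ratio_le) auto
    finally show ?thesis .
  qed
  then have "(\<Sum>u\<in>U. t u * ln (s u / t u) - t u * ln (Z / T)) \<le> (\<Sum>u\<in>U. s u * T / Z - t u)"
    by (rule sum_mono)
  also have "\<dots> = Z * T / Z - T"
    by (simp add: sum_subtractf T_def Z_def sum_distrib_right sum_divide_distrib)
  also have "\<dots> = 0" using Z by simp
  finally have "(\<Sum>u\<in>U. t u * ln (s u / t u)) \<le> T * ln (Z / T)"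
    by (simp add: sum_subtractf sum_distrib_right[symmetric] T_def)
  then have "(\<Sum>u\<in>U. t u * ln (s u / t u)) / ln B \<le> T * ln (Z / T) / ln B"
    using B by (intro divide_right_mono) auto
  then show ?thesis by (simp add: log_def sum_divide_distrib T_def Z_def)
qed

section \<open>b-adic cells as integers, the parent of a cell being an integer quotient\<close>

lemma mem_badic: "0 < b \<Longrightarrow> x \<in> badic b i c \<longleftrightarrow> \<lfloor>real b ^ i * x\<rfloor> = c"
  unfolding badic_def by (auto simp: floor_eq_iff field_simps)

lemma badic_sets [measurable, simp]: "badic b i c \<in> sets borel"
  by (simp add: badic_def)

lemma disjoint_family_badic: "0 < b \<Longrightarrow> disjoint_family_on (badic b i) X"
  by (auto simp: disjoint_family_on_def mem_badic)

definition children :: "nat \<Rightarrow> nat \<Rightarrow> int \<Rightarrow> int set" where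
  "children b m c = {d. d div int b ^ m = c}"

lemma int_le_div_iff:
  fixes B :: int assumes "0 < B" shows "n \<le> d div B \<longleftrightarrow> n * B \<le> d"
proof
  assume "n \<le> d div B"
  then have "n * B \<le> (d div B) * B" using assms by (intro mult_right_mono) auto
  also have "\<dots> \<le> d" using div_mult_mod_eq[of d B] pos_mod_sign[OF assms, of d] by linarith
  finally show "n * B \<le> d" .
next
  assume "n * B \<le> d"
  then have "n * B div B \<le> d div B" using assms by (rule zdiv_mono1)
  then show "n \<le> d div B" using assms by simp
qed

lemma children_eq:
  assumes "0 < b" shows "children b m c = {c * int b ^ m ..< (c + 1) * int b ^ m}"
proof -
  have B: "0 < int b ^ m" using assms by simp
  have "d div int b ^ m = c \<longleftrightarrow> d \<in> {c * int b ^ m ..< (c + 1) * int b ^ m}" for d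
  proof -
    have "d div int b ^ m = c \<longleftrightarrow> c \<le> d div int b ^ m \<and> \<not> c + 1 \<le> d div int b ^ m"
      by linarith
    then show ?thesis unfolding int_le_div_iff[OF B] by (simp only: atLeastLessThan_iff not_le)
  qed
  then show ?thesis unfolding children_def by blast
qed

lemma children_disjoint: "c \<noteq> c' \<Longrightarrow> children b m c \<inter> children b m c' = {}"
  by (auto simp: children_def)

lemma finite_children [simp]: "0 < b \<Longrightarrow> finite (children b m c)"
  by (simp add: children_eq)

lemma floor_parent:
  assumes "0 < b" shows "\<lfloor>real b ^ i * x\<rfloor> = \<lfloor>real b ^ (i + m) * x\<rfloor> div int b ^ m"
proof -
  have "\<lfloor>real b ^ (i + m) * x / real_of_int (int b ^ m)\<rfloor> = \<lfloor>real b ^ (i + m) * x\<rfloor> div int b ^ m"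
    by (rule floor_divide_real_eq_div) simp
  moreover have "real b ^ (i + m) * x / real_of_int (int b ^ m) = real b ^ i * x"
    using assms by (simp add: power_add)
  ultimately show ?thesis by simp
qed

lemma badic_Int:
  assumes "0 < b"
  shows "badic b (i + m) d \<inter> badic b i c = (if d \<in> children b m c then badic b (i + m) d else {})"
proof -
  have "x \<in> badic b i c \<longleftrightarrow> d \<in> children b m c" if "x \<in> badic b (i + m) d" for x
    using that floor_parent[OF assms, of i x m] by (simp add: mem_badic assms children_def)
  then show ?thesis by auto
qed

lemma badic_UN_children:
  assumes "0 < b" shows "badic b i c = (\<Union>d\<in>children b m c. badic b (i + m) d)"
proof -
  have "x \<in> badic b i c \<longleftrightarrow> x \<in> (\<Union>d\<in>children b m c. badic b (i + m) d)" for x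
    using floor_parent[OF assms, of i x m] by (simp add: mem_badic assms children_def)
  then show ?thesis by blast
qed

locale badic_measure = prob_space M for M :: "real measure" +
  fixes b :: nat
  assumes b2: "2 \<le> b" and sets_M [simp, measurable_cong]: "sets M = sets borel"
begin

definition cell_prob :: "nat \<Rightarrow> int \<Rightarrow> real" where "cell_prob i c = prob (badic b i c)"

text \<open>The mass of the cell times the entropy of the normalised restriction. Without the
  normalisation null cells are harmless, and each summand has the form t log (s / t) of the log-sum
  inequality.\<close>

definition cond_ent :: "nat \<Rightarrow> nat \<Rightarrow> int \<Rightarrow> real" where
  "cond_ent i m c = (\<Sum>d\<in>children b m c. cell_prob (i + m) d * log (real b) (cell_prob i c / cell_prob (i + m) d))"

lemma b_pos: "0 < b" "0 < real b" "1 < real b" using b2 by auto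

lemma space_M [simp]: "space M = UNIV" using sets_eq_imp_space_eq[OF sets_M] by simp

lemma cell_prob_nonneg [simp]: "0 \<le> cell_prob i c" by (simp add: cell_prob_def)

lemma sum_cell_prob:
  assumes "finite X" shows "(\<Sum>c\<in>X. cell_prob i c) = prob (\<Union>c\<in>X. badic b i c)"
  unfolding cell_prob_def using assms b_pos
  by (intro finite_measure_finite_Union[symmetric] disjoint_family_badic) auto

lemma sum_cell_prob_le_1: "finite X \<Longrightarrow> (\<Sum>c\<in>X. cell_prob i c) \<le> 1"
  by (simp add: sum_cell_prob)

lemma cell_prob_le_1: "cell_prob i c \<le> 1" by (simp add: cell_prob_def)

lemma cell_prob_children: "cell_prob i c = (\<Sum>d\<in>children b m c. cell_prob (i + m) d)"
  using b_pos by (simp add: sum_cell_prob badic_UN_children[of b i c m, symmetric]) (simp add: cell_prob_def)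

lemma cell_prob_child_le: "d \<in> children b m c \<Longrightarrow> cell_prob (i + m) d \<le> cell_prob i c"
  using b_pos by (subst cell_prob_children[of i c m]) (auto intro!: member_le_sum)

text \<open>The form that telescopes when summed over cells: -p log p over the children minus the
  same for the parent.\<close>

lemma cond_ent_eq: "cond_ent i m c = (\<Sum>d\<in>children b m c. - cell_prob (i + m) d * log (real b) (cell_prob (i + m) d)) + cell_prob i c * log (real b) (cell_prob i c)"
proof -
  have "cell_prob (i + m) d * log (real b) (cell_prob i c / cell_prob (i + m) d) =
    - cell_prob (i + m) d * log (real b) (cell_prob (i + m) d) + cell_prob (i + m) d * log (real b) (cell_prob i c)" if "d \<in> children b m c" for d
  proof (cases "cell_prob (i + m) d = 0")
    case False
    then have "0 < cell_prob (i + m) d" "0 < cell_prob i c"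
      using cell_prob_child_le[OF that, of i] cell_prob_nonneg[of "i + m" d] by linarith+
    then show ?thesis using b_pos by (simp add: log_divide algebra_simps)
  qed simp
  then have "cond_ent i m c = (\<Sum>d\<in>children b m c. - cell_prob (i + m) d * log (real b) (cell_prob (i + m) d) + cell_prob (i + m) d * log (real b) (cell_prob i c))"
    unfolding cond_ent_def by (intro sum.cong) auto
  then show ?thesis
    unfolding sum.distrib sum_distrib_right[symmetric] cell_prob_children[of i c m, symmetric] .
qed

text \<open>Cells that are not children contribute 0, so the infinite sum is finite. For a null cell
  both sides vanish, since division by zero gives 0.\<close>

lemma cell_prob_mult_part_entropy:
  "cell_prob i \<lfloor>real b ^ i * x\<rfloor> * part_entropy b (restr_norm M b i x) (i + m) = cond_ent i m \<lfloor>real b ^ i * x\<rfloor>"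
proof -
  define c where "c = \<lfloor>real b ^ i * x\<rfloor>"
  have cell: "badic_cell b i x = badic b i c" by (simp add: badic_cell_def c_def)
  have r: "restr_norm M b i x (badic b (i + m) d) = (if d \<in> children b m c then cell_prob (i + m) d / cell_prob i c else 0)" for d
    using b_pos by (auto simp: restr_norm_def cell badic_Int cell_prob_def)
  have "part_entropy b (restr_norm M b i x) (i + m)
     = (\<Sum>\<^sub>\<infinity>d\<in>children b m c. - (cell_prob (i + m) d / cell_prob i c) * log (real b) (cell_prob (i + m) d / cell_prob i c))"
    unfolding part_entropy_def r by (rule infsum_cong_neutral) auto
  also have "\<dots> = (\<Sum>d\<in>children b m c. - (cell_prob (i + m) d / cell_prob i c) * log (real b) (cell_prob (i + m) d / cell_prob i c))"
    using b_pos by simp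
  finally have "cell_prob i c * part_entropy b (restr_norm M b i x) (i + m) =
    (\<Sum>d\<in>children b m c. cell_prob i c * (- (cell_prob (i + m) d / cell_prob i c) * log (real b) (cell_prob (i + m) d / cell_prob i c)))"
    by (simp add: sum_distrib_left)
  also have "\<dots> = cond_ent i m c"
    unfolding cond_ent_def
  proof (rule sum.cong)
    fix d assume d: "d \<in> children b m c"
    show "cell_prob i c * (- (cell_prob (i + m) d / cell_prob i c) * log (real b) (cell_prob (i + m) d / cell_prob i c)) =
      cell_prob (i + m) d * log (real b) (cell_prob i c / cell_prob (i + m) d)"
    proof (cases "cell_prob (i + m) d = 0")
      case False
      then have "0 < cell_prob (i + m) d" "0 < cell_prob i c"
        using cell_prob_child_le[OF d, of i] cell_prob_nonneg[of "i + m" d] by linarith+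
      then show ?thesis using b_pos by (simp add: log_divide algebra_simps)
    qed simp
  qed simp
  finally show ?thesis by (simp add: c_def)
qed

text \<open>A child of mass p \<le> b^-\<kappa> contributes -p log p \<ge> \<kappa> p; the heavier
  children, of total mass at most \<open>G\<close>, are simply dropped. Subtracting the parents'
  entropy costs 1 / ln b per non-null parent. Later this is applied to a single piece, which meets
  boundedly many cells.\<close>

lemma sum_cond_ent_lower:
  assumes fin: "finite X" and \<kappa>: "0 \<le> \<kappa>" and card: "card {c \<in> X. 0 < cell_prob i c} \<le> N"
    and G: "\<And>Y. finite Y \<Longrightarrow> (\<And>d. d \<in> Y \<Longrightarrow> real b powr - \<kappa> < cell_prob (i + m) d) \<Longrightarrow> (\<Sum>d\<in>Y. cell_prob (i + m) d) \<le> G"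
  shows "\<kappa> * ((\<Sum>c\<in>X. cell_prob i c) - G) - real N / ln (real b) \<le> (\<Sum>c\<in>X. cond_ent i m c)"
proof -
  define H where "H c = {d \<in> children b m c. real b powr - \<kappa> < cell_prob (i + m) d}" for c
  have fH: "finite (H c)" for c unfolding H_def using b_pos by simp
  have 1: "\<kappa> * (cell_prob i c - (\<Sum>d\<in>H c. cell_prob (i + m) d)) \<le> (\<Sum>d\<in>children b m c. - cell_prob (i + m) d * log (real b) (cell_prob (i + m) d))" for c
  proof -
    have "cell_prob i c - (\<Sum>d\<in>H c. cell_prob (i + m) d) = (\<Sum>d\<in>children b m c - H c. cell_prob (i + m) d)"
      using b_pos by (subst cell_prob_children[of i c m], subst sum_diff) (auto simp: H_def)
    then have "\<kappa> * (cell_prob i c - (\<Sum>d\<in>H c. cell_prob (i + m) d)) = (\<Sum>d\<in>children b m c - H c. \<kappa> * cell_prob (i + m) d)"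
      by (simp add: sum_distrib_left)
    also have "\<dots> \<le> (\<Sum>d\<in>children b m c - H c. - cell_prob (i + m) d * log (real b) (cell_prob (i + m) d))"
    proof (rule sum_mono)
      fix d assume d: "d \<in> children b m c - H c"
      then have le: "cell_prob (i + m) d \<le> real b powr - \<kappa>" by (auto simp: H_def)
      show "\<kappa> * cell_prob (i + m) d \<le> - cell_prob (i + m) d * log (real b) (cell_prob (i + m) d)"
      proof (cases "cell_prob (i + m) d = 0")
        case False
        then have "0 < cell_prob (i + m) d" using cell_prob_nonneg[of "i + m" d] by linarith
        then have "log (real b) (cell_prob (i + m) d) \<le> - \<kappa>"
          using le b_pos by (simp add: log_le_iff)
        then have "\<kappa> \<le> - log (real b) (cell_prob (i + m) d)" by simp
        then have "\<kappa> * cell_prob (i + m) d \<le> - log (real b) (cell_prob (i + m) d) * cell_prob (i + m) d"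
          by (rule mult_right_mono) simp
        then show ?thesis by (simp add: mult.commute)
      qed simp
    qed
    also have "\<dots> \<le> (\<Sum>d\<in>children b m c. - cell_prob (i + m) d * log (real b) (cell_prob (i + m) d))"
    proof (rule sum_mono2)
      show "0 \<le> - cell_prob (i + m) d * log (real b) (cell_prob (i + m) d)" for d
        using cell_prob_le_1[of "i + m" d] b_pos cell_prob_nonneg[of "i + m" d]
        by (cases "cell_prob (i + m) d = 0") (auto simp: mult_nonneg_nonpos zero_le_mult_iff log_le_zero_cancel_iff order_less_le)
    qed (use b_pos in auto)
    finally show ?thesis .
  qed
  \<comment> \<open>From p ln (1 / p) \<le> 1 - p \<le> 1.\<close>
  have 2: "- (if 0 < cell_prob i c then 1 / ln (real b) else 0) \<le> cell_prob i c * log (real b) (cell_prob i c)" for c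
  proof (cases "0 < cell_prob i c")
    case True
    have "cell_prob i c * ln (1 / cell_prob i c) \<le> 1 - cell_prob i c" using True by (intro mult_ln_ratio_le) auto
    then have "- 1 \<le> cell_prob i c * ln (cell_prob i c)" using True by (simp add: ln_div)
    then have "- 1 / ln (real b) \<le> cell_prob i c * ln (cell_prob i c) / ln (real b)"
      using b_pos by (intro divide_right_mono) auto
    then show ?thesis using True by (simp add: log_def)
  next
    case False
    then have "cell_prob i c = 0" using cell_prob_nonneg[of i c] by linarith
    then show ?thesis by simp
  qed
  have 3: "(\<Sum>c\<in>X. \<Sum>d\<in>H c. cell_prob (i + m) d) \<le> G"
  proof -
    have "(\<Sum>c\<in>X. \<Sum>d\<in>H c. cell_prob (i + m) d) = (\<Sum>d\<in>(\<Union>c\<in>X. H c). cell_prob (i + m) d)"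
      using fin fH by (intro sum.UNION_disjoint[symmetric]) (auto simp: H_def children_def)
    also have "\<dots> \<le> G" using fin fH by (intro G) (auto simp: H_def)
    finally show ?thesis .
  qed
  have "(\<Sum>c\<in>X. if 0 < cell_prob i c then 1 / ln (real b) else 0) = real (card {c \<in> X. 0 < cell_prob i c}) * (1 / ln (real b))"
    using fin by (simp add: sum.If_cases Int_def)
  also have "\<dots> \<le> real N / ln (real b)"
    using card b_pos by (simp add: divide_right_mono)
  finally have 4: "(\<Sum>c\<in>X. if 0 < cell_prob i c then 1 / ln (real b) else 0) \<le> real N / ln (real b)" .
  have "\<kappa> * ((\<Sum>c\<in>X. cell_prob i c) - G) - real N / ln (real b)
    \<le> \<kappa> * ((\<Sum>c\<in>X. cell_prob i c) - (\<Sum>c\<in>X. \<Sum>d\<in>H c. cell_prob (i + m) d)) + - (\<Sum>c\<in>X. if 0 < cell_prob i c then 1 / ln (real b) else 0)"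
    using 3 4 mult_left_mono[OF 3 \<kappa>] by (simp add: right_diff_distrib)
  also have "\<dots> = (\<Sum>c\<in>X. \<kappa> * (cell_prob i c - (\<Sum>d\<in>H c. cell_prob (i + m) d)) + - (if 0 < cell_prob i c then 1 / ln (real b) else 0))"
    by (simp add: sum.distrib sum_negf sum_distrib_left sum_subtractf right_diff_distrib)
  also have "\<dots> \<le> (\<Sum>c\<in>X. cond_ent i m c)"
    unfolding cond_ent_eq using 1 2 by (intro sum_mono add_mono) auto
  finally show ?thesis .
qed

end

locale bounded_badic_measure = badic_measure +
  fixes A :: nat
  assumes A0: "0 < A" and supp: "prob {y. \<bar>y\<bar> < real A} = 1"
begin

definition cells :: "nat \<Rightarrow> int set" where
  "cells i = {- (int A * int b ^ i) ..< int A * int b ^ i}"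

definition ent :: "nat \<Rightarrow> real" where
  "ent i = (\<Sum>c\<in>cells i. - cell_prob i c * log (real b) (cell_prob i c))"

lemma finite_cells [simp]: "finite (cells i)" by (simp add: cells_def)

lemma card_cells: "real (card (cells i)) = 2 * real A * real b ^ i"
  by (simp add: cells_def)

lemma floor_in_cells: assumes "\<bar>y\<bar> < real A" shows "\<lfloor>real b ^ i * y\<rfloor> \<in> cells i"
proof -
  have B: "0 < real b ^ i" using b_pos by simp
  have "- real A \<le> y" "y < real A" using assms by auto
  then have "real b ^ i * (- real A) \<le> real b ^ i * y" "real b ^ i * y < real b ^ i * real A"
    using mult_left_mono[of "- real A" y "real b ^ i"] mult_strict_left_mono[of y "real A" "real b ^ i"] B
    by (blast intro: less_imp_le)+
  then show ?thesis
    by (simp add: cells_def le_floor_iff floor_less_iff mult.commute)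
qed

lemma sum_cell_prob_cells: "(\<Sum>c\<in>cells i. cell_prob i c) = 1"
proof -
  have "1 \<le> (\<Sum>c\<in>cells i. cell_prob i c)"
    unfolding sum_cell_prob[OF finite_cells] supp[symmetric]
    using floor_in_cells b_pos by (intro finite_measure_mono) (auto simp: mem_badic)
  then show ?thesis using sum_cell_prob_le_1[OF finite_cells, of i i] by linarith
qed

text \<open>Any property that depends only on the cell becomes a finite sum, because the cells of
  [-\<open>A\<close>, \<open>A\<close>) carry all the mass.\<close>

lemma prob_Collect_cell:
  "prob {x. P \<lfloor>real b ^ i * x\<rfloor>} = (\<Sum>c\<in>{c \<in> cells i. P c}. cell_prob i c)"
proof -
  let ?E = "{x. P \<lfloor>real b ^ i * x\<rfloor>}"
  have E[measurable]: "?E \<in> sets borel"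
  proof -
    have "{x \<in> space borel. P \<lfloor>real b ^ i * x\<rfloor>} \<in> sets borel" by measurable
    then show ?thesis by simp
  qed
  have A[measurable]: "{y. \<bar>y\<bar> < real A} \<in> sets borel" by measurable
  have U[measurable]: "(\<Union>c\<in>{c \<in> cells i. P c}. badic b i c) \<in> sets borel" by measurable
  have ae: "AE y in M. \<bar>y\<bar> < real A"
    using supp prob_Collect_eq_1[of "\<lambda>y. \<bar>y\<bar> < real A"] by auto
  have "prob ?E = prob (\<Union>c\<in>{c \<in> cells i. P c}. badic b i c)"
  proof (rule finite_measure_eq_AE)
    show "AE x in M. x \<in> ?E \<longleftrightarrow> x \<in> (\<Union>c\<in>{c \<in> cells i. P c}. badic b i c)"
      using ae by eventually_elim (use floor_in_cells b_pos in \<open>auto simp: mem_badic\<close>)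
  qed auto
  then show ?thesis by (simp add: sum_cell_prob)
qed

lemma cells_UN_children: "cells (i + m) = (\<Union>c\<in>cells i. children b m c)"
proof -
  have B: "0 < int b ^ m" using b_pos by simp
  have "d \<in> cells (i + m) \<longleftrightarrow> d div int b ^ m \<in> cells i" for d
  proof -
    have "d div int b ^ m < int A * int b ^ i \<longleftrightarrow> d < int A * int b ^ i * int b ^ m"
      using int_le_div_iff[OF B, of "int A * int b ^ i" d] by (simp add: not_le[symmetric])
    moreover have "- (int A * int b ^ i) \<le> d div int b ^ m \<longleftrightarrow> - (int A * int b ^ i) * int b ^ m \<le> d"
      by (rule int_le_div_iff[OF B])
    ultimately show ?thesis by (simp add: cells_def power_add mult.assoc)
  qed
  then show ?thesis by (auto simp: children_def)
qed

text \<open>The chain rule for entropy: the total conditional entropy is the gain from level i to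
  level i + m.\<close>

lemma sum_cond_ent: "(\<Sum>c\<in>cells i. cond_ent i m c) = ent (i + m) - ent i"
proof -
  have "(\<Sum>c\<in>cells i. \<Sum>d\<in>children b m c. - cell_prob (i + m) d * log (real b) (cell_prob (i + m) d)) = ent (i + m)"
    unfolding ent_def cells_UN_children
    using b_pos by (intro sum.UNION_disjoint[symmetric]) (simp_all add: children_disjoint)
  then show ?thesis unfolding cond_ent_eq sum.distrib by (simp add: ent_def sum_negf)
qed

lemma ent_nonneg: "0 \<le> ent i"
  unfolding ent_def
proof (rule sum_nonneg)
  show "0 \<le> - cell_prob i c * log (real b) (cell_prob i c)" for c
    using cell_prob_le_1[of i c] b_pos cell_prob_nonneg[of i c]
    by (cases "cell_prob i c = 0") (auto simp: mult_nonneg_nonpos zero_le_mult_iff log_le_zero_cancel_iff order_less_le)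
qed

text \<open>A cell whose neighbourhood has mass at least b^-\<kappa> costs at most \<kappa> + log 10
  per unit of mass; for the others, of total mass at most \<open>G\<close>, the uniform half of the
  reference weights still gives about i. Neighbourhoods replace cells because a ball may straddle
  cell boundaries: one of radius 2 b^-i stays within two cells on either side.\<close>

lemma ent_upper:
  assumes \<kappa>: "0 \<le> \<kappa>"
    and G: "(\<Sum>c\<in>{c \<in> cells i. (\<Sum>e\<in>{c-2..c+2}. cell_prob i e) < real b powr - \<kappa>}. cell_prob i c) \<le> G"
  shows "ent i \<le> \<kappa> + log (real b) 10 + G * (real i + log (real b) (4 * real A))"
proof -
  define f where "f c = (\<Sum>e\<in>{c-2..c+2}. cell_prob i e)" for c
  define N where "N = 4 * real A * real b ^ i"
  define p where "p c = f c / 10 + 1 / N" for c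
    \<comment> \<open>Reference weights for Gibbs' inequality: half the mass of the enlarged cell (each point lies in five
      of these), half the uniform distribution on the cells.\<close>
  define Bad where "Bad = {c \<in> cells i. f c < real b powr - \<kappa>}"
  have N0: "0 < N" using A0 b_pos by (simp add: N_def)
  have f0: "0 \<le> f c" for c by (simp add: f_def sum_nonneg)
  have p0: "0 < p c" for c using f0[of c] N0 by (simp add: p_def add_nonneg_pos)
  have f5: "(\<Sum>c\<in>cells i. f c) \<le> 5"
  proof -
    have "f c = (\<Sum>k\<in>{-2..2}. cell_prob i (c + k))" for c
      unfolding f_def by (rule sum.reindex_bij_witness[where i="\<lambda>k. c + k" and j="\<lambda>e. e - c"]) auto
    then have "(\<Sum>c\<in>cells i. f c) = (\<Sum>k\<in>{-2..2}. \<Sum>c\<in>cells i. cell_prob i (c + k))"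
      by (simp add: sum.swap[of _ "{-2..2}"])
    also have "\<dots> \<le> (\<Sum>k\<in>{-2..2::int}. 1)"
    proof (rule sum_mono)
      fix k
      have "(\<Sum>c\<in>cells i. cell_prob i (c + k)) = (\<Sum>e\<in>(\<lambda>c. c + k) ` cells i. cell_prob i e)"
        by (subst sum.reindex) (auto simp: inj_on_def)
      also have "\<dots> \<le> 1" by (rule sum_cell_prob_le_1) simp
      finally show "(\<Sum>c\<in>cells i. cell_prob i (c + k)) \<le> 1" .
    qed
    finally show ?thesis by simp
  qed
  have "(\<Sum>c\<in>cells i. p c) = (\<Sum>c\<in>cells i. f c) / 10 + real (card (cells i)) / N"
    by (simp add: p_def sum.distrib sum_divide_distrib)
  also have "real (card (cells i)) / N = 1 / 2"
    using A0 b_pos unfolding card_cells N_def by (simp add: field_simps)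
  finally have "(\<Sum>c\<in>cells i. p c) \<le> (\<Sum>c\<in>cells i. cell_prob i c)"
    using f5 by (simp add: sum_cell_prob_cells)
  then have "ent i \<le> (\<Sum>c\<in>cells i. - cell_prob i c * log (real b) (p c))"
    unfolding ent_def using p0 b_pos by (intro gibbs_inequality) auto
  also have "\<dots> \<le> (\<Sum>c\<in>cells i. cell_prob i c * (\<kappa> + log (real b) 10) + (if c \<in> Bad then cell_prob i c * log (real b) N else 0))"
  proof (rule sum_mono)
    fix c assume c: "c \<in> cells i"
    have l10: "0 \<le> log (real b) 10" using b_pos by simp
    have "- log (real b) (p c) \<le> (\<kappa> + log (real b) 10) + (if c \<in> Bad then log (real b) N else 0)"
    proof (cases "c \<in> Bad")
      case True
      have "1 / N \<le> p c" using f0[of c] by (simp add: p_def)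
      then have "log (real b) (1 / N) \<le> log (real b) (p c)" using N0 b_pos p0[of c] by simp
      moreover have "log (real b) (1 / N) = - log (real b) N" using N0 b_pos by (simp add: log_divide)
      ultimately have "- log (real b) (p c) \<le> log (real b) N" by linarith
      then show ?thesis using True \<kappa> l10 unfolding if_P[OF True] by linarith
    next
      case False
      then have "real b powr - \<kappa> \<le> f c" using c by (auto simp: Bad_def)
      then have "real b powr - \<kappa> / 10 \<le> p c" using N0 by (simp add: p_def add_increasing2)
      then have "log (real b) (real b powr - \<kappa> / 10) \<le> log (real b) (p c)"
        using b_pos p0[of c] by simp
      then show ?thesis using False b_pos by (simp add: log_divide)
    qed
    then have "cell_prob i c * - log (real b) (p c) \<le> cell_prob i c * ((\<kappa> + log (real b) 10) + (if c \<in> Bad then log (real b) N else 0))"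
      by (intro mult_left_mono) auto
    then show "- cell_prob i c * log (real b) (p c) \<le> cell_prob i c * (\<kappa> + log (real b) 10) + (if c \<in> Bad then cell_prob i c * log (real b) N else 0)"
      by (cases "c \<in> Bad") (simp_all add: distrib_left)
  qed
  also have "\<dots> = (\<kappa> + log (real b) 10) + (\<Sum>c\<in>Bad. cell_prob i c) * log (real b) N"
  proof -
    have "(\<Sum>c\<in>cells i. if c \<in> Bad then cell_prob i c * log (real b) N else 0) = (\<Sum>c\<in>Bad. cell_prob i c * log (real b) N)"
      by (rule sum.mono_neutral_cong_right) (auto simp: Bad_def)
    then show ?thesis
      by (simp add: sum.distrib sum_distrib_right[symmetric] sum_cell_prob_cells)
  qed
  also have "\<dots> \<le> (\<kappa> + log (real b) 10) + G * log (real b) N"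
  proof -
    \<comment> \<open>The mass of \<open>Bad\<close> may be replaced by its bound \<open>G\<close>
      only because log \<open>N\<close> is nonnegative.\<close>
    have "1 \<le> real A" "1 \<le> real b ^ i" using A0 b_pos by (auto intro: one_le_power)
    then have "1 * 1 \<le> real A * real b ^ i" by (intro mult_mono) auto
    then have "1 \<le> N" by (simp add: N_def)
    then have "0 \<le> log (real b) N" using b_pos by simp
    then show ?thesis using G by (intro add_left_mono mult_right_mono) (auto simp: Bad_def f_def)
  qed
  also have "log (real b) N = real i + log (real b) (4 * real A)"
    using A0 b_pos by (simp add: N_def log_mult log_nat_power)
  finally show ?thesis .
qed

end

section \<open>Entropy bounds for the measures m_x\<close>

context weierstrass
begin

lemma A_pos: "0 < A"
  using S_bound[of 0 "\<lambda>_. 0"] by (cases A) auto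

sublocale m: bounded_badic_measure "\<mu> x" b A for x
proof -
  interpret P: prob_space "\<mu> x" by (rule prob_space_mu)
  show "bounded_badic_measure (\<mu> x) b A"
  proof unfold_locales
    show "measure (\<mu> x) {y. \<bar>y\<bar> < real A} = 1"
      using S_bound prob_space_seq_measure[of b, THEN prob_space.prob_space]
      by (subst measure_mu) auto
  qed (use b2 A_pos in auto)
qed

sublocale p: badic_measure "piece u x" b for u x
proof -
  interpret P: prob_space "piece u x" by (rule prob_space_piece)
  show "badic_measure (piece u x) b" by unfold_locales (use b2 in auto)
qed

lemma cell_prob_pieces: "m.cell_prob x i c = (\<Sum>u\<in>words b p. p.cell_prob u x i c) / real b ^ p"
  unfolding m.cell_prob_def p.cell_prob_def by (rule measure_mu_pieces) simp

text \<open>The log-sum inequality for each child, with the pieces as index; the normalisation b^p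
  cancels inside the logarithm.\<close>

lemma cond_ent_pieces: "(\<Sum>u\<in>words b p. p.cond_ent u x i m c) / real b ^ p \<le> m.cond_ent x i m c"
proof -
  let ?t = "\<lambda>d u. p.cell_prob u x (i + m) d" and ?s = "\<lambda>u. p.cell_prob u x i c"
  have "(\<Sum>u\<in>words b p. p.cond_ent u x i m c) = (\<Sum>d\<in>children b m c. \<Sum>u\<in>words b p. ?t d u * log (real b) (?s u / ?t d u))"
    unfolding p.cond_ent_def by (rule sum.swap)
  also have "\<dots> \<le> (\<Sum>d\<in>children b m c. sum (?t d) (words b p) * log (real b) (sum ?s (words b p) / sum (?t d) (words b p)))"
    using b_pos by (intro sum_mono log_sum_inequality) (auto intro: p.cell_prob_child_le)
  finally have "(\<Sum>u\<in>words b p. p.cond_ent u x i m c) / real b ^ p \<le>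
     (\<Sum>d\<in>children b m c. sum (?t d) (words b p) * log (real b) (sum ?s (words b p) / sum (?t d) (words b p))) / real b ^ p"
    by (rule divide_right_mono) simp
  also have "\<dots> = m.cond_ent x i m c"
    unfolding m.cond_ent_def cell_prob_pieces[where p=p] sum_divide_distrib
    using b_pos by (intro sum.cong) (auto simp: sum_divide_distrib[symmetric])
  finally show ?thesis .
qed

text \<open>In units of b^-i every point of the piece lies within \<open>A\<close> of the offset;
  taking floors adds at most one cell on each side.\<close>

lemma card_piece_cells:
  assumes "\<gamma> ^ length u * real b ^ i \<le> 1" "finite X"
  shows "card {c \<in> X. 0 < p.cell_prob u x i c} \<le> 2 * A + 3"
proof -
  define v where "v = real b ^ i * offset u x"
  have "{c \<in> X. 0 < p.cell_prob u x i c} \<subseteq> {\<lfloor>v\<rfloor> - int A - 1 .. \<lfloor>v\<rfloor> + int A + 1}"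
  proof safe
    fix c assume "0 < p.cell_prob u x i c"
    then have "{j. offset u x + \<gamma> ^ length u * S (word_map b u x) j \<in> badic b i c} \<noteq> {}"
      unfolding p.cell_prob_def measure_piece[OF badic_sets] by (metis less_irrefl measure_empty)
    then obtain j where "offset u x + \<gamma> ^ length u * S (word_map b u x) j \<in> badic b i c" by blast
    then have c: "c = \<lfloor>v + \<gamma> ^ length u * real b ^ i * S (word_map b u x) j\<rfloor>"
      using b_pos by (simp add: mem_badic v_def algebra_simps)
    have "\<bar>\<gamma> ^ length u * real b ^ i * S (word_map b u x) j\<bar> \<le> 1 * real A"
      unfolding abs_mult[of "\<gamma> ^ length u * real b ^ i"]
      using assms(1) \<gamma>0 S_bound[of "word_map b u x" j] by (intro mult_mono) auto
    then show "c \<in> {\<lfloor>v\<rfloor> - int A - 1 .. \<lfloor>v\<rfloor> + int A + 1}"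
      unfolding c atLeastAtMost_iff by linarith
  qed
  then have "card {c \<in> X. 0 < p.cell_prob u x i c} \<le> card {\<lfloor>v\<rfloor> - int A - 1 .. \<lfloor>v\<rfloor> + int A + 1}"
    by (rule card_mono[rotated]) simp
  then show ?thesis by simp
qed

text \<open>Undoing the scaling of the piece, a cell of level i + m pulls back to a set of diameter
  at most 1 / (\<gamma> b^m), so each point of a heavy cell has a heavy ball for the measure at
  u(x).\<close>

lemma piece_heavy_cells:
  assumes \<gamma>: "\<gamma> \<le> \<gamma> ^ length u * real b ^ i" and "finite Y" and Y: "\<And>d. d \<in> Y \<Longrightarrow> t < p.cell_prob u x (i + m) d"
  shows "(\<Sum>d\<in>Y. p.cell_prob u x (i + m) d) \<le> heavy_prob (1 / (\<gamma> * real b ^ m)) t (word_map b u x)"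
proof -
  define z where "z = word_map b u x"
  define g where "g j = offset u x + \<gamma> ^ length u * S z j" for j
  have close: "\<bar>S z j' - S z j\<bar> < 1 / (\<gamma> * real b ^ m)" if "g j \<in> badic b (i + m) d" "g j' \<in> badic b (i + m) d" for d j j'
  proof -
    have "\<lfloor>real b ^ (i + m) * g j\<rfloor> = \<lfloor>real b ^ (i + m) * g j'\<rfloor>" using that b_pos by (simp add: mem_badic)
    then have "\<bar>real b ^ (i + m) * g j' - real b ^ (i + m) * g j\<bar> < 1" by linarith
    also have "real b ^ (i + m) * g j' - real b ^ (i + m) * g j = (\<gamma> ^ length u * real b ^ i) * (real b ^ m * (S z j' - S z j))"
      by (simp add: g_def power_add algebra_simps)
    also have "\<bar>\<dots>\<bar> = (\<gamma> ^ length u * real b ^ i) * (real b ^ m * \<bar>S z j' - S z j\<bar>)"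
      using \<gamma>0 by (simp add: abs_mult)
    finally have "\<gamma> * (real b ^ m * \<bar>S z j' - S z j\<bar>) < 1"
      using mult_right_mono[OF \<gamma>, of "real b ^ m * \<bar>S z j' - S z j\<bar>"] by simp
    then show ?thesis using \<gamma>0 b_pos by (simp add: field_simps)
  qed
  have "(\<Sum>d\<in>Y. p.cell_prob u x (i + m) d) = prob {j. g j \<in> (\<Union>d\<in>Y. badic b (i + m) d)}"
    using \<open>finite Y\<close> by (simp add: p.sum_cell_prob measure_piece sets.finite_UN g_def z_def)
  also have "\<dots> \<le> prob {j. t < ball_prob z (1 / (\<gamma> * real b ^ m)) j}"
  proof (intro finite_measure_mono sets_Collect_ball_prob subsetI)
    fix j assume "j \<in> {j. g j \<in> (\<Union>d\<in>Y. badic b (i + m) d)}"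
    then obtain d where d: "d \<in> Y" "g j \<in> badic b (i + m) d" by auto
    have "t < p.cell_prob u x (i + m) d" by (rule Y) fact
    also have "p.cell_prob u x (i + m) d = prob {j'. g j' \<in> badic b (i + m) d}"
      by (simp add: p.cell_prob_def measure_piece g_def z_def)
    also have "\<dots> \<le> ball_prob z (1 / (\<gamma> * real b ^ m)) j"
      unfolding ball_prob_def using close[OF d(2)] by (intro finite_measure_mono sets_Collect_S) auto
    finally show "j \<in> {j. t < ball_prob z (1 / (\<gamma> * real b ^ m)) j}" by simp
  qed measurable
  finally show ?thesis by (simp add: heavy_prob_def z_def)
qed

text \<open>The pieces of generation p have diameter comparable to the cells, so each meets boundedly many
  of them, and cutting a piece along the cells costs only a bounded amount of entropy.\<close>

lemma sum_cond_ent_mu_lower: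
  assumes "\<gamma> ^ p * real b ^ i \<le> 1" "\<gamma> \<le> \<gamma> ^ p * real b ^ i" "finite X" "0 \<le> \<kappa>"
  shows "\<kappa> * (\<Sum>c\<in>X. m.cell_prob x i c)
      - \<kappa> * ((\<Sum>u\<in>words b p. heavy_prob (1 / (\<gamma> * real b ^ m)) (real b powr - \<kappa>) (word_map b u x)) / real b ^ p)
      - real (2 * A + 3) / ln (real b) \<le> (\<Sum>c\<in>X. m.cond_ent x i m c)"
proof -
  let ?g = "\<lambda>u. heavy_prob (1 / (\<gamma> * real b ^ m)) (real b powr - \<kappa>) (word_map b u x)"
  have 1: "\<kappa> * ((\<Sum>c\<in>X. p.cell_prob u x i c) - ?g u) - real (2 * A + 3) / ln (real b) \<le> (\<Sum>c\<in>X. p.cond_ent u x i m c)"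
    if u: "u \<in> words b p" for u
    using assms words_length[OF u]
    by (intro p.sum_cond_ent_lower card_piece_cells piece_heavy_cells) auto
  have "(\<Sum>u\<in>words b p. \<kappa> * ((\<Sum>c\<in>X. p.cell_prob u x i c) - ?g u) - real (2 * A + 3) / ln (real b)) / real b ^ p
     \<le> (\<Sum>u\<in>words b p. \<Sum>c\<in>X. p.cond_ent u x i m c) / real b ^ p"
    using 1 by (intro divide_right_mono sum_mono) auto
  also have "\<dots> = (\<Sum>c\<in>X. (\<Sum>u\<in>words b p. p.cond_ent u x i m c) / real b ^ p)"
    by (subst sum.swap) (simp add: sum_divide_distrib)
  also have "\<dots> \<le> (\<Sum>c\<in>X. m.cond_ent x i m c)" by (intro sum_mono cond_ent_pieces)
  also have "(\<Sum>u\<in>words b p. \<kappa> * ((\<Sum>c\<in>X. p.cell_prob u x i c) - ?g u) - real (2 * A + 3) / ln (real b)) / real b ^ p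
    = \<kappa> * (\<Sum>c\<in>X. m.cell_prob x i c) - \<kappa> * ((\<Sum>u\<in>words b p. ?g u) / real b ^ p) - real (2 * A + 3) / ln (real b)"
  proof -
    have "(\<Sum>c\<in>X. m.cell_prob x i c) = (\<Sum>u\<in>words b p. \<Sum>c\<in>X. p.cell_prob u x i c) / real b ^ p"
      unfolding cell_prob_pieces[where p=p] sum_divide_distrib[symmetric] by (subst sum.swap) simp
    moreover have "(\<Sum>u\<in>words b p. \<kappa> * ((\<Sum>c\<in>X. p.cell_prob u x i c) - ?g u) - real (2 * A + 3) / ln (real b))
      = \<kappa> * ((\<Sum>u\<in>words b p. \<Sum>c\<in>X. p.cell_prob u x i c) - (\<Sum>u\<in>words b p. ?g u)) - real b ^ p * (real (2 * A + 3) / ln (real b))"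
      by (simp add: sum_subtractf sum_distrib_left[symmetric] card_words)
    moreover have "0 < real b ^ p" using b_pos by simp
    ultimately show ?thesis by (simp add: diff_divide_distrib right_diff_distrib)
  qed
  finally show ?thesis .
qed

text \<open>Take the least p with \<gamma>^p \<le> b^-i; minimality means an overshoot by at most
  one factor \<gamma>.\<close>

lemma ex_generation:
  "\<exists>p. \<gamma> ^ p * real b ^ i \<le> 1 \<and> \<gamma> \<le> \<gamma> ^ p * real b ^ i"
proof -
  have B: "0 < real b ^ i" using b_pos by simp
  have "\<exists>p. \<gamma> ^ p < 1 / real b ^ i" using \<gamma>1 B by (intro real_arch_pow_inv) auto
  then have ex: "\<exists>p. \<gamma> ^ p * real b ^ i \<le> 1" using B by (auto simp: field_simps intro: less_imp_le)
  define p where "p = (LEAST p. \<gamma> ^ p * real b ^ i \<le> 1)"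
  have 1: "\<gamma> ^ p * real b ^ i \<le> 1" unfolding p_def using ex by (rule LeastI_ex)
  have "\<gamma> \<le> \<gamma> ^ p * real b ^ i"
  proof (cases p)
    case 0
    have "1 \<le> real b ^ i" using b_pos by (intro one_le_power) simp
    then show ?thesis using 0 \<gamma>1 by simp
  next
    case (Suc k)
    then have "\<not> \<gamma> ^ k * real b ^ i \<le> 1" using not_less_Least[of k "\<lambda>p. \<gamma> ^ p * real b ^ i \<le> 1"] by (simp add: p_def)
    then have "\<gamma> * 1 \<le> \<gamma> * (\<gamma> ^ k * real b ^ i)" using \<gamma>0 by (intro mult_left_mono) auto
    then show ?thesis using Suc by (simp add: mult.assoc)
  qed
  with 1 show ?thesis by blast
qed

lemma floor_pred: "Measurable.pred borel (\<lambda>y::real. P \<lfloor>real b ^ i * y\<rfloor>)"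
  by measurable

text \<open>If |v' - v| < 2 the floors of v and v' differ by at most 2, so a light five-cell
  neighbourhood forces a light ball of radius 2 b^-i.\<close>

lemma ent_mu_upper:
  assumes "0 \<le> \<kappa>"
  shows "m.ent x i \<le> \<kappa> + log (real b) 10
    + light_prob (2 / real b ^ i) (real b powr - \<kappa>) x * (real i + log (real b) (4 * real A))"
  using assms
proof (rule m.ent_upper)
  let ?X = "{c \<in> m.cells i. (\<Sum>e\<in>{c-2..c+2}. m.cell_prob x i e) < real b powr - \<kappa>}"
  have cell_prob: "(\<Sum>c\<in>Y. m.cell_prob x i c) = prob {j. \<lfloor>real b ^ i * S x j\<rfloor> \<in> Y}" if "finite Y" for Y
    using that b_pos by (simp add: m.sum_cell_prob measure_mu sets.finite_UN mem_badic)
  have "(\<Sum>c\<in>?X. m.cell_prob x i c) = prob {j. \<lfloor>real b ^ i * S x j\<rfloor> \<in> ?X}"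
    by (rule cell_prob) simp
  also have "\<dots> \<le> prob {j. ball_prob x (2 / real b ^ i) j < real b powr - \<kappa>}"
  proof (intro finite_measure_mono sets_Collect_ball_prob subsetI)
    fix j assume "j \<in> {j. \<lfloor>real b ^ i * S x j\<rfloor> \<in> ?X}"
    define c where "c = \<lfloor>real b ^ i * S x j\<rfloor>"
    have "ball_prob x (2 / real b ^ i) j \<le> (\<Sum>e\<in>{c-2..c+2}. m.cell_prob x i e)"
      unfolding ball_prob_def cell_prob[OF finite_atLeastAtMost_int]
    proof (intro finite_measure_mono sets_Collect_S subsetI)
      fix j' assume "j' \<in> {j'. \<bar>S x j' - S x j\<bar> < 2 / real b ^ i}"
      then have "real b ^ i * \<bar>S x j' - S x j\<bar> < 2" using b_pos by (simp add: field_simps)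
      then have "\<bar>real b ^ i * S x j' - real b ^ i * S x j\<bar> < 2"
        by (simp add: right_diff_distrib[symmetric] abs_mult)
      then show "j' \<in> {j'. \<lfloor>real b ^ i * S x j'\<rfloor> \<in> {c-2..c+2}}"
        unfolding c_def mem_Collect_eq atLeastAtMost_iff by linarith
    qed (rule floor_pred)
    also have "\<dots> < real b powr - \<kappa>"
      using \<open>j \<in> {j. \<lfloor>real b ^ i * S x j\<rfloor> \<in> ?X}\<close> by (simp add: c_def)
    finally show "j \<in> {j. ball_prob x (2 / real b ^ i) j < real b powr - \<kappa>}" by simp
  qed measurable
  finally show "(\<Sum>c\<in>?X. m.cell_prob x i c) \<le> light_prob (2 / real b ^ i) (real b powr - \<kappa>) x"
    by (simp add: light_prob_def)
qed

end

section \<open>Averaging over words\<close>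

text \<open>The levels common to both sums cancel; the first m levels, entering with a minus sign,
  are discarded by nonnegativity.\<close>

lemma sum_shift_diff_le:
  fixes f :: "nat \<Rightarrow> real"
  assumes "\<And>i. 0 \<le> f i"
  shows "(\<Sum>i=1..k. f (i + m) - f i) \<le> (\<Sum>i=k+1..k+m. f i)"
proof -
  have "(\<Sum>i=1..k. f (i + m)) = (\<Sum>i=1+m..k+m. f i)"
    by (rule sum.shift_bounds_cl_nat_ivl[symmetric])
  also have "\<dots> \<le> (\<Sum>i=1..k+m. f i)"
    using assms by (intro sum_mono2) auto
  also have "\<dots> = (\<Sum>i=1..k. f i) + (\<Sum>i=k+1..k+m. f i)"
    using sum.ub_add_nat[of 1 k f m] by simp
  finally show ?thesis by (simp add: sum_subtractf)
qed

context weierstrass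
begin

text \<open>The conditional measure depends only on the cell, so its left endpoint serves as
  representative.\<close>

definition cell_entropy :: "nat \<Rightarrow> real \<Rightarrow> nat \<Rightarrow> int \<Rightarrow> real" where
  "cell_entropy m x i c = part_entropy b (restr_norm (\<mu> x) b i (real_of_int c / real b ^ i)) (i + m)"

text \<open>The mass of the high-entropy cells. The negated strict inequality makes it the exact
  complement of the set in the definition of porosity.\<close>

definition bad :: "real \<Rightarrow> nat \<Rightarrow> real \<Rightarrow> nat \<Rightarrow> real" where
  "bad h m x i = (\<Sum>c\<in>{c \<in> m.cells i. \<not> 1 / real m * cell_entropy m x i c < h}. m.cell_prob x i c)"

lemma floor_cell: "\<lfloor>real b ^ i * (real_of_int c / real b ^ i)\<rfloor> = c"
  using b_pos by simp

lemma part_entropy_eq_cell_entropy: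
  "part_entropy b (restr_norm (\<mu> x) b i y) (i + m) = cell_entropy m x i \<lfloor>real b ^ i * y\<rfloor>"
proof -
  have "restr_norm (\<mu> x) b i y = restr_norm (\<mu> x) b i (real_of_int \<lfloor>real b ^ i * y\<rfloor> / real b ^ i)"
    unfolding restr_norm_def badic_cell_def floor_cell ..
  then show ?thesis by (simp add: cell_entropy_def)
qed

lemma cell_prob_cell_entropy: "m.cell_prob x i c * cell_entropy m x i c = m.cond_ent x i m c"
  using m.cell_prob_mult_part_entropy[of x i "real_of_int c / real b ^ i" m]
  unfolding floor_cell cell_entropy_def .

lemma measure_low_entropy:
  "measure (\<mu> x) {y. 1 / real m * part_entropy b (restr_norm (\<mu> x) b i y) (i + m) < h} = 1 - bad h m x i"
proof -
  let ?X = "{c \<in> m.cells i. 1 / real m * cell_entropy m x i c < h}"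
  have "measure (\<mu> x) {y. 1 / real m * part_entropy b (restr_norm (\<mu> x) b i y) (i + m) < h} = (\<Sum>c\<in>?X. m.cell_prob x i c)"
    unfolding part_entropy_eq_cell_entropy by (rule m.prob_Collect_cell)
  moreover have "(\<Sum>c\<in>m.cells i. m.cell_prob x i c) = (\<Sum>c\<in>?X. m.cell_prob x i c) + bad h m x i"
    unfolding bad_def by (subst sum.union_disjoint[symmetric]) (auto intro!: sum.cong)
  ultimately show ?thesis by (simp add: m.sum_cell_prob_cells)
qed

lemma entropy_porous_iff:
  assumes "0 < k"
  shows "entropy_porous b (\<mu> x) \<alpha> \<epsilon> m 1 k \<longleftrightarrow> (\<Sum>i=1..k. bad (\<alpha> + \<epsilon>) m x i) < real k * \<epsilon>"
proof -
  have "entropy_porous b (\<mu> x) \<alpha> \<epsilon> m 1 k \<longleftrightarrow> 1 - \<epsilon> < (\<Sum>i=1..k. 1 - bad (\<alpha> + \<epsilon>) m x i) / real k"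
    unfolding entropy_porous_def measure_low_entropy by simp
  also have "\<dots> \<longleftrightarrow> (\<Sum>i=1..k. bad (\<alpha> + \<epsilon>) m x i) < real k * \<epsilon>"
    using assms by (simp add: sum_subtractf field_simps)
  finally show ?thesis .
qed

text \<open>Low-entropy cells contribute about m \<tau> per unit of mass by the bound through
  pieces, bad ones at least m (\<alpha> + \<epsilon>) by definition. As \<tau> \<le> \<alpha>, the
  bad ones yield a surplus m \<epsilon> over the baseline m \<tau>; \<tau> \<le> 1 only simplifies
  the heavy-ball error.\<close>

lemma bad_step:
  assumes p: "\<gamma> ^ p * real b ^ i \<le> 1" "\<gamma> \<le> \<gamma> ^ p * real b ^ i"
    and \<tau>: "0 \<le> \<tau>" "\<tau> \<le> 1" "\<tau> \<le> \<alpha>" and m: "0 < m"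
  shows "real m * \<tau> + real m * \<epsilon> * bad (\<alpha> + \<epsilon>) m x i \<le> m.ent x (i + m) - m.ent x i
    + real m * ((\<Sum>u\<in>words b p. heavy_prob (1 / (\<gamma> * real b ^ m)) (real b powr - (real m * \<tau>)) (word_map b u x)) / real b ^ p)
    + real (2 * A + 3) / ln (real b)"
proof -
  define g where "g = (\<Sum>u\<in>words b p. heavy_prob (1 / (\<gamma> * real b ^ m)) (real b powr - (real m * \<tau>)) (word_map b u x)) / real b ^ p"
  define c0 where "c0 = real (2 * A + 3) / ln (real b)"
  define \<beta> where "\<beta> = bad (\<alpha> + \<epsilon>) m x i"
  let ?X = "{c \<in> m.cells i. 1 / real m * cell_entropy m x i c < \<alpha> + \<epsilon>}"
  let ?Y = "{c \<in> m.cells i. \<not> 1 / real m * cell_entropy m x i c < \<alpha> + \<epsilon>}"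
  have split: "(\<Sum>c\<in>m.cells i. f c) = (\<Sum>c\<in>?X. f c) + (\<Sum>c\<in>?Y. f c)" for f :: "int \<Rightarrow> real"
    by (subst sum.union_disjoint[symmetric]) (auto intro!: sum.cong)
  have g0: "0 \<le> g" unfolding g_def heavy_prob_def by (intro divide_nonneg_nonneg sum_nonneg) auto
  have \<beta>0: "0 \<le> \<beta>" unfolding \<beta>_def bad_def by (intro sum_nonneg) auto
  have X: "(\<Sum>c\<in>?X. m.cell_prob x i c) = 1 - \<beta>"
    using split[of "m.cell_prob x i"] by (simp add: m.sum_cell_prob_cells \<beta>_def bad_def)
  have 1: "real m * \<tau> * (1 - \<beta>) - real m * \<tau> * g - c0 \<le> (\<Sum>c\<in>?X. m.cond_ent x i m c)"
    using sum_cond_ent_mu_lower[OF p, of ?X "real m * \<tau>" x m] \<tau> unfolding X g_def c0_def by simp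
  have 2: "real m * (\<alpha> + \<epsilon>) * \<beta> \<le> (\<Sum>c\<in>?Y. m.cond_ent x i m c)"
    unfolding \<beta>_def bad_def sum_distrib_left
  proof (rule sum_mono)
    fix c assume "c \<in> ?Y"
    then have "real m * (\<alpha> + \<epsilon>) \<le> cell_entropy m x i c" using m by (simp add: not_less field_simps)
    then have "m.cell_prob x i c * (real m * (\<alpha> + \<epsilon>)) \<le> m.cell_prob x i c * cell_entropy m x i c"
      by (rule mult_left_mono) simp
    then show "real m * (\<alpha> + \<epsilon>) * m.cell_prob x i c \<le> m.cond_ent x i m c" unfolding cell_prob_cell_entropy by (simp only: mult.commute)
  qed
  have "real m * \<tau> * \<beta> \<le> real m * \<alpha> * \<beta>" using \<tau> \<beta>0 by (intro mult_right_mono mult_left_mono) auto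
  moreover have "real m * \<tau> * g \<le> real m * 1 * g" using \<tau> g0 by (intro mult_right_mono mult_left_mono) auto
  moreover have "m.ent x (i + m) - m.ent x i = (\<Sum>c\<in>?X. m.cond_ent x i m c) + (\<Sum>c\<in>?Y. m.cond_ent x i m c)"
    unfolding m.sum_cond_ent[symmetric] by (rule split)
  ultimately show ?thesis
    using 1 2 unfolding g_def[symmetric] c0_def[symmetric] \<beta>_def[symmetric]
    by (simp add: algebra_simps)
qed

lemma heavy_prob_bounds: "0 \<le> heavy_prob r t x" "heavy_prob r t x \<le> 1" by (simp_all add: heavy_prob_def)

lemma light_prob_bounds: "0 \<le> light_prob r t x" "light_prob r t x \<le> 1" by (simp_all add: light_prob_def)

text \<open>The double average over w and u is one average over words of length n + p, whose
  cylinders are shorter still, so the requirement on n is independent of p. The perturbation doubles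
  the radius 1 / (\<gamma> b^m).\<close>

lemma avg_heavy_prob:
  assumes "lip_const / real b ^ n \<le> 1 / (2 * real b ^ m)"
  shows "(\<Sum>w\<in>words b n. (\<Sum>u\<in>words b p. heavy_prob (1 / (\<gamma> * real b ^ m)) t (word_map b u (word_map b w 0))) / real b ^ p) / real b ^ n
    \<le> (\<integral>z. heavy_prob (2 / \<gamma> / real b ^ m) t z \<partial>unif)"
proof -
  have "(\<Sum>w\<in>words b n. (\<Sum>u\<in>words b p. heavy_prob (1 / (\<gamma> * real b ^ m)) t (word_map b u (word_map b w 0))) / real b ^ p) / real b ^ n
    = (\<Sum>v\<in>words b (n + p). heavy_prob (1 / (\<gamma> * real b ^ m)) t (word_map b v 0)) / real b ^ (n + p)"
    using b_pos by (simp add: sum_words_add word_map_append sum_divide_distrib[symmetric] power_add mult.commute)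
  also have "\<dots> \<le> (\<integral>z. heavy_prob (2 / \<gamma> / real b ^ m) t z \<partial>unif)"
  proof (rule sum_words_le_integral)
    fix x z assume xz: "\<bar>x - z\<bar> \<le> 1 / real b ^ (n + p)"
    have B: "1 \<le> real b ^ p" "0 < real b ^ n" using b_pos by (auto intro: one_le_power)
    have "1 / real b ^ (n + p) \<le> 1 / real b ^ n"
      using b_pos B mult_left_mono[OF B(1), of "real b ^ n"] by (intro divide_left_mono) (auto simp: power_add)
    then have "lip_const * \<bar>x - z\<bar> \<le> lip_const * (1 / real b ^ n)"
      using xz lip_const_nonneg by (intro mult_left_mono) linarith+
    also have "\<dots> \<le> 1 / (2 * real b ^ m)" using assms by simp
    also have "\<dots> \<le> 1 / (2 * \<gamma> * real b ^ m)"
      using \<gamma>0 \<gamma>1 b_pos by (intro divide_left_mono) (auto simp: mult_le_cancel_right2)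
    finally have "heavy_prob (1 / (\<gamma> * real b ^ m)) t x \<le> heavy_prob (1 / (\<gamma> * real b ^ m) + 2 * (1 / (2 * \<gamma> * real b ^ m))) t z"
      by (rule heavy_prob_perturb)
    also have "1 / (\<gamma> * real b ^ m) + 2 * (1 / (2 * \<gamma> * real b ^ m)) = 2 / \<gamma> / real b ^ m"
      using \<gamma>0 b_pos by (simp add: field_simps)
    finally show "heavy_prob (1 / (\<gamma> * real b ^ m)) t x \<le> heavy_prob (2 / \<gamma> / real b ^ m) t z" .
  qed (use heavy_prob_bounds in auto)
  finally show ?thesis .
qed

text \<open>Radius 2 b^-i at x becomes b^-i at z, the difference being twice the permitted
  displacement b^-i / 2.\<close>

lemma avg_light_prob:
  assumes "lip_const / real b ^ n \<le> 1 / (2 * real b ^ i)"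
  shows "(\<Sum>w\<in>words b n. light_prob (2 / real b ^ i) t (word_map b w 0)) / real b ^ n
    \<le> (\<integral>z. light_prob (1 / real b ^ i) t z \<partial>unif)"
proof (rule sum_words_le_integral)
  fix x z assume "\<bar>x - z\<bar> \<le> 1 / real b ^ n"
  then have "lip_const * \<bar>x - z\<bar> \<le> lip_const * (1 / real b ^ n)"
    using lip_const_nonneg by (intro mult_left_mono)
  also have "\<dots> \<le> 1 / (2 * real b ^ i)" using assms by simp
  finally have "light_prob (1 / real b ^ i + 2 * (1 / (2 * real b ^ i))) t x \<le> light_prob (1 / real b ^ i) t z"
    by (rule light_prob_perturb)
  then show "light_prob (2 / real b ^ i) t x \<le> light_prob (1 / real b ^ i) t z" by (simp add: add_divide_distrib[symmetric])
qed (use light_prob_bounds in auto)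

text \<open>\<open>bad_step\<close> summed over the levels 1, ..., k and averaged over words. Upper
  entropy bounds, with \<kappa> = i \<sigma>, are needed only for the m levels above k that survive
  the telescoping.\<close>

lemma avg_bad:
  assumes \<tau>: "0 \<le> \<tau>" "\<tau> \<le> 1" "\<tau> \<le> \<alpha>" and \<sigma>: "0 \<le> \<sigma>" and m: "0 < m"
    and n: "lip_const / real b ^ n \<le> 1 / (2 * real b ^ (k + m))"
    and heavy_prob: "(\<integral>z. heavy_prob (2 / \<gamma> / real b ^ m) (real b powr - (real m * \<tau>)) z \<partial>unif) \<le> e"
    and light_prob: "\<And>i. k \<le> i \<Longrightarrow> (\<integral>z. light_prob (1 / real b ^ i) (real b powr - (real i * \<sigma>)) z \<partial>unif) \<le> e"
  shows "real k * (real m * \<tau>) + real m * \<epsilon> * ((\<Sum>w\<in>words b n. \<Sum>i=1..k. bad (\<alpha> + \<epsilon>) m (word_map b w 0) i) / real b ^ n)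
    \<le> real m * (real (k + m) * \<sigma> + log (real b) 10 + e * (real (k + m) + log (real b) (4 * real A)))
      + real k * (real m * e) + real k * (real (2 * A + 3) / ln (real b))"
proof -
  obtain P where P: "\<And>i. \<gamma> ^ P i * real b ^ i \<le> 1" "\<And>i. \<gamma> \<le> \<gamma> ^ P i * real b ^ i"
    using ex_generation by metis
  define c0 where "c0 = real (2 * A + 3) / ln (real b)"
  define lA where "lA = log (real b) (4 * real A)"
  define l10 where "l10 = log (real b) 10"
  define g where "g x i = (\<Sum>u\<in>words b (P i). heavy_prob (1 / (\<gamma> * real b ^ m)) (real b powr - (real m * \<tau>)) (word_map b u x)) / real b ^ P i" for x i
  define h where "h x i = light_prob (2 / real b ^ i) (real b powr - (real i * \<sigma>)) x" for x i
  define avg where "avg f = (\<Sum>w\<in>words b n. f (word_map b w 0)) / real b ^ n" for f :: "real \<Rightarrow> real"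
  have bn: "0 < real b ^ n" using b_pos by simp
  have avg_mono: "avg f \<le> avg f'" if "\<And>x. f x \<le> f' x" for f f'
    unfolding avg_def using that by (intro divide_right_mono sum_mono) auto
  have avg_add: "avg (\<lambda>x. f x + f' x) = avg f + avg f'" for f f'
    by (simp add: avg_def sum.distrib add_divide_distrib)
  have avg_const: "avg (\<lambda>x. c) = c" for c
    using bn by (simp add: avg_def card_words)
  have avg_mult: "avg (\<lambda>x. c * f x) = c * avg f" for c f
    by (simp add: avg_def sum_distrib_left)
  have avg_sum: "avg (\<lambda>x. \<Sum>i\<in>I. f x i) = (\<Sum>i\<in>I. avg (\<lambda>x. f x i))" for f and I :: "nat set"
    unfolding avg_def sum_divide_distrib by (rule sum.swap)
  have lA0: "0 \<le> lA" using A_pos b_pos by (simp add: lA_def)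
  have e0: "0 \<le> e"
    using light_prob[of k] light_prob_bounds by (intro order_trans[OF integral_nonneg_AE]) auto
  have pt: "real k * (real m * \<tau>) + real m * \<epsilon> * (\<Sum>i=1..k. bad (\<alpha> + \<epsilon>) m x i)
    \<le> (\<Sum>i=k+1..k+m. real i * \<sigma> + l10 + (real i + lA) * h x i) + real m * (\<Sum>i=1..k. g x i) + real k * c0" for x
  proof -
    have "real k * (real m * \<tau>) + real m * \<epsilon> * (\<Sum>i=1..k. bad (\<alpha> + \<epsilon>) m x i)
      = (\<Sum>i=1..k. real m * \<tau> + real m * \<epsilon> * bad (\<alpha> + \<epsilon>) m x i)"
      by (simp add: sum.distrib sum_distrib_left)
    also have "\<dots> \<le> (\<Sum>i=1..k. (m.ent x (i + m) - m.ent x i) + real m * g x i + c0)"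
      unfolding g_def c0_def using P \<tau> m by (intro sum_mono bad_step) auto
    also have "\<dots> = (\<Sum>i=1..k. m.ent x (i + m) - m.ent x i) + real m * (\<Sum>i=1..k. g x i) + real k * c0"
      unfolding sum.distrib by (simp add: sum_distrib_left)
    also have "(\<Sum>i=1..k. m.ent x (i + m) - m.ent x i) \<le> (\<Sum>i=k+1..k+m. m.ent x i)"
      by (rule sum_shift_diff_le) (rule m.ent_nonneg)
    also have "\<dots> \<le> (\<Sum>i=k+1..k+m. real i * \<sigma> + l10 + (real i + lA) * h x i)"
    proof (rule sum_mono)
      fix i
      show "m.ent x i \<le> real i * \<sigma> + l10 + (real i + lA) * h x i"
        using ent_mu_upper[of "real i * \<sigma>" x i] \<sigma> by (simp add: l10_def lA_def h_def mult.commute)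
    qed
    finally show ?thesis by simp
  qed
  have h_le: "avg (\<lambda>x. h x i) \<le> e" if "i \<in> {k+1..k+m}" for i
  proof -
    \<comment> \<open>The finest scale that occurs is b^-(k + m), so the hypothesis on n covers all
      levels of the window.\<close>
    have "real b ^ i \<le> real b ^ (k + m)" using that b_pos by (intro power_increasing) auto
    then have "1 / (2 * real b ^ (k + m)) \<le> 1 / (2 * real b ^ i)"
      using b_pos by (intro divide_left_mono) auto
    then have "avg (\<lambda>x. h x i) \<le> (\<integral>z. light_prob (1 / real b ^ i) (real b powr - (real i * \<sigma>)) z \<partial>unif)"
      unfolding avg_def h_def using n by (intro avg_light_prob) linarith
    also have "\<dots> \<le> e" using that by (intro light_prob) auto
    finally show ?thesis .
  qed
  have g_le: "avg (\<lambda>x. g x i) \<le> e" for i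
  proof -
    have "real b ^ m \<le> real b ^ (k + m)" using b_pos by (intro power_increasing) auto
    then have "1 / (2 * real b ^ (k + m)) \<le> 1 / (2 * real b ^ m)"
      using b_pos by (intro divide_left_mono) auto
    then have "avg (\<lambda>x. g x i) \<le> (\<integral>z. heavy_prob (2 / \<gamma> / real b ^ m) (real b powr - (real m * \<tau>)) z \<partial>unif)"
      unfolding avg_def g_def using n by (intro avg_heavy_prob) linarith
    also have "\<dots> \<le> e" by (rule heavy_prob)
    finally show ?thesis .
  qed
  have "real k * (real m * \<tau>) + real m * \<epsilon> * avg (\<lambda>x. \<Sum>i=1..k. bad (\<alpha> + \<epsilon>) m x i)
    = avg (\<lambda>x. real k * (real m * \<tau>) + real m * \<epsilon> * (\<Sum>i=1..k. bad (\<alpha> + \<epsilon>) m x i))"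
    by (simp add: avg_add avg_mult avg_const)
  also have "\<dots> \<le> avg (\<lambda>x. (\<Sum>i=k+1..k+m. real i * \<sigma> + l10 + (real i + lA) * h x i) + real m * (\<Sum>i=1..k. g x i) + real k * c0)"
    by (rule avg_mono) (rule pt)
  also have "\<dots> = (\<Sum>i=k+1..k+m. real i * \<sigma> + l10 + (real i + lA) * avg (\<lambda>x. h x i)) + real m * (\<Sum>i=1..k. avg (\<lambda>x. g x i)) + real k * c0"
    by (simp only: avg_add avg_mult avg_const avg_sum)
  also have "\<dots> \<le> (\<Sum>i=k+1..k+m. real (k + m) * \<sigma> + l10 + (real (k + m) + lA) * e) + real m * (\<Sum>i=1..k. e) + real k * c0"
  proof (intro add_mono mult_left_mono sum_mono order_refl)
    fix i assume i: "i \<in> {k+1..k+m}"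
    show "real i * \<sigma> \<le> real (k + m) * \<sigma>" using i \<sigma> by (intro mult_right_mono) auto
    have "(real i + lA) * avg (\<lambda>x. h x i) \<le> (real i + lA) * e"
      using h_le[OF i] lA0 by (intro mult_left_mono) auto
    also have "\<dots> \<le> (real (k + m) + lA) * e" using i e0 by (intro mult_right_mono) auto
    finally show "(real i + lA) * avg (\<lambda>x. h x i) \<le> (real (k + m) + lA) * e" .
  qed (use g_le in auto)
  also have "\<dots> = real m * (real (k + m) * \<sigma> + l10 + e * (real (k + m) + lA)) + real k * (real m * e) + real k * c0"
    by (simp add: algebra_simps)
  finally show ?thesis unfolding avg_def l10_def lA_def c0_def .
qed

lemma entropy_porous_typical:
  assumes \<alpha>: "0 \<le> \<alpha>" "\<alpha> \<le> 1"
    and ae: "AE x in lborel. x \<in> {0..1} \<longrightarrow> exact_dimensional (\<mu> x) \<alpha>"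
    and \<epsilon>: "0 < \<epsilon>"
  shows "\<exists>M1. \<forall>m\<ge>M1. \<exists>K1. \<forall>k\<ge>K1. \<exists>N1. \<forall>n\<ge>N1.
    1 - \<epsilon> < real (card {w \<in> words b n. entropy_porous b (\<mu> (word_map b w 0)) \<alpha> \<epsilon> m 1 k}) / real b ^ n"
proof -
  \<comment> \<open>The final estimate collects seven errors of size k e: two from \<sigma> -
    \<tau>, one from m \<sigma> + \<open>l10\<close>, two from the light balls, one from the heavy
    balls, one from \<open>c0\<close>. Being below 8 k e = k \<epsilon>^3, they give \<epsilon> V <
    k \<epsilon>^3.\<close>
  define e where "e = \<epsilon> ^ 3 / 8"
  \<comment> \<open>Truncated at 0 because the lower bound requires \<kappa> = m \<tau> to be
    nonnegative.\<close>
  define \<tau> where "\<tau> = max 0 (\<alpha> - e)"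
  define \<sigma> where "\<sigma> = \<alpha> + e"
  define c0 where "c0 = real (2 * A + 3) / ln (real b)"
  define lA where "lA = log (real b) (4 * real A)"
  define l10 where "l10 = log (real b) 10"
  have e0: "0 < e" using \<epsilon> by (simp add: e_def)
  have \<tau>: "0 \<le> \<tau>" "\<tau> \<le> 1" "\<tau> \<le> \<alpha>" "\<alpha> - e \<le> \<tau>" "\<tau> < \<alpha> \<or> \<tau> = 0"
    using \<alpha> e0 by (auto simp: \<tau>_def)
  have \<sigma>: "0 \<le> \<sigma>" "\<alpha> < \<sigma>" using \<alpha> e0 by (auto simp: \<sigma>_def)
  have "(\<lambda>m. \<integral>z. heavy_prob (2 / \<gamma> / real b ^ m) (real b powr - (real m * \<tau>)) z \<partial>unif) \<longlonglongrightarrow> 0"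
  proof (rule integral_unif_tendsto_0)
    show "AE z in lborel. z \<in> {0..1} \<longrightarrow> (\<lambda>m. heavy_prob (2 / \<gamma> / real b ^ m) (real b powr - (real m * \<tau>)) z) \<longlonglongrightarrow> 0"
      using ae
    proof (rule AE_mp, intro AE_I2 impI)
      fix z :: real assume "z \<in> {0..1} \<longrightarrow> exact_dimensional (\<mu> z) \<alpha>" "z \<in> {0..1}"
      then show "(\<lambda>m. heavy_prob (2 / \<gamma> / real b ^ m) (real b powr - (real m * \<tau>)) z) \<longlonglongrightarrow> 0"
        using \<gamma>0 \<tau>(5) by (intro heavy_prob_tendsto[of _ \<alpha>]) auto
    qed
  qed (use heavy_prob_bounds in auto)
  then have "\<forall>\<^sub>F m in sequentially. (\<integral>z. heavy_prob (2 / \<gamma> / real b ^ m) (real b powr - (real m * \<tau>)) z \<partial>unif) < e"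
    using e0 by (rule order_tendstoD)
  then obtain Ml where Ml: "\<And>m. Ml \<le> m \<Longrightarrow> (\<integral>z. heavy_prob (2 / \<gamma> / real b ^ m) (real b powr - (real m * \<tau>)) z \<partial>unif) < e"
    unfolding eventually_sequentially by blast
  have "(\<lambda>i. \<integral>z. light_prob (1 / real b ^ i) (real b powr - (real i * \<sigma>)) z \<partial>unif) \<longlonglongrightarrow> 0"
  proof (rule integral_unif_tendsto_0)
    show "AE z in lborel. z \<in> {0..1} \<longrightarrow> (\<lambda>i. light_prob (1 / real b ^ i) (real b powr - (real i * \<sigma>)) z) \<longlonglongrightarrow> 0"
      using ae
    proof (rule AE_mp, intro AE_I2 impI)
      fix z :: real assume "z \<in> {0..1} \<longrightarrow> exact_dimensional (\<mu> z) \<alpha>" "z \<in> {0..1}"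
      then show "(\<lambda>i. light_prob (1 / real b ^ i) (real b powr - (real i * \<sigma>)) z) \<longlonglongrightarrow> 0"
        using \<sigma>(2) by (intro light_prob_tendsto[of _ \<alpha>]) auto
    qed
  qed (use light_prob_bounds in auto)
  then have "\<forall>\<^sub>F i in sequentially. (\<integral>z. light_prob (1 / real b ^ i) (real b powr - (real i * \<sigma>)) z \<partial>unif) < e"
    using e0 by (rule order_tendstoD)
  then obtain Ku where Ku: "\<And>i. Ku \<le> i \<Longrightarrow> (\<integral>z. light_prob (1 / real b ^ i) (real b powr - (real i * \<sigma>)) z \<partial>unif) < e"
    unfolding eventually_sequentially by blast
  \<comment> \<open>The heavy-ball integral is below \<open>e\<close>, and the cutting cost
    \<open>c0\<close> is at most \<open>e\<close> m.\<close>
  define M1 where "M1 = max (max Ml 1) (nat \<lceil>c0 / e\<rceil>)"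
  show ?thesis
  proof (rule exI[of _ M1], intro allI impI)
    fix m assume "M1 \<le> m"
    then have m: "Ml \<le> m" "0 < m" "c0 / e \<le> real m"
      unfolding M1_def by linarith+
    have c0m: "c0 \<le> e * real m" using m(3) e0 by (simp add: field_simps)
    \<comment> \<open>Every level of the window has a small light-ball integral, and the terms
      depending on m are absorbed by k.\<close>
    define K1 where "K1 = max (max Ku 1) (max (nat \<lceil>(real m * \<sigma> + l10) / e\<rceil>) (nat \<lceil>real m + lA\<rceil>))"
    show "\<exists>K1. \<forall>k\<ge>K1. \<exists>N1. \<forall>n\<ge>N1.
      1 - \<epsilon> < real (card {w \<in> words b n. entropy_porous b (\<mu> (word_map b w 0)) \<alpha> \<epsilon> m 1 k}) / real b ^ n"
    proof (rule exI[of _ K1], intro allI impI)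
      fix k assume "K1 \<le> k"
      then have k: "Ku \<le> k" "0 < k" "(real m * \<sigma> + l10) / e \<le> real k" "real m + lA \<le> real k"
        unfolding K1_def by linarith+
      have k3: "real m * \<sigma> + l10 \<le> e * real k" using k(3) e0 by (simp add: field_simps)
      have "(\<lambda>n. lip_const * (1 / real b) ^ n) \<longlonglongrightarrow> lip_const * 0"
        using b_pos by (intro tendsto_mult tendsto_const LIMSEQ_realpow_zero) auto
      then have "(\<lambda>n. lip_const / real b ^ n) \<longlonglongrightarrow> 0" by (simp add: power_divide)
      moreover have "0 < 1 / (2 * real b ^ (k + m))" using b_pos by simp
      ultimately have "\<forall>\<^sub>F n in sequentially. lip_const / real b ^ n < 1 / (2 * real b ^ (k + m))"
        by (rule order_tendstoD)
      then obtain N1 where N1: "\<And>n. N1 \<le> n \<Longrightarrow> lip_const / real b ^ n < 1 / (2 * real b ^ (k + m))"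
        unfolding eventually_sequentially by blast
      show "\<exists>N1. \<forall>n\<ge>N1.
        1 - \<epsilon> < real (card {w \<in> words b n. entropy_porous b (\<mu> (word_map b w 0)) \<alpha> \<epsilon> m 1 k}) / real b ^ n"
      proof (rule exI[of _ N1], intro allI impI)
        fix n assume n: "N1 \<le> n"
        define X where "X w = (\<Sum>i=1..k. bad (\<alpha> + \<epsilon>) m (word_map b w 0) i)" for w
        define V where "V = (\<Sum>w\<in>words b n. X w) / real b ^ n"
        have bn: "0 < real b ^ n" using b_pos by simp
        have X0: "0 \<le> X w" for w unfolding X_def bad_def by (intro sum_nonneg) auto
        have "real k * (real m * \<tau>) + real m * \<epsilon> * V
          \<le> real m * (real (k + m) * \<sigma> + l10 + e * (real (k + m) + lA)) + real k * (real m * e) + real k * c0"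
          unfolding V_def X_def l10_def lA_def c0_def
          using N1[OF n] Ml[OF m(1)] Ku k(1) \<tau> \<sigma> m(2)
          by (intro avg_bad) (auto intro: less_imp_le order_trans)
        also have "\<dots> \<le> real m * (real (k + m) * \<sigma> + l10 + e * (real (k + m) + lA)) + real k * (real m * e) + real k * (e * real m)"
          using c0m by (intro add_left_mono mult_left_mono) auto
        finally have "real m * (real k * \<tau> + \<epsilon> * V)
          \<le> real m * (real (k + m) * \<sigma> + l10 + e * (real (k + m) + lA) + real k * e + real k * e)"
          by (simp add: algebra_simps)
        then have "real k * \<tau> + \<epsilon> * V \<le> real (k + m) * \<sigma> + l10 + e * (real (k + m) + lA) + real k * e + real k * e"
          using m(2) by (subst (asm) mult_le_cancel_left_pos) auto
        also have "\<dots> = real k * \<sigma> + (real m * \<sigma> + l10) + e * (real k + (real m + lA)) + 2 * (real k * e)"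
          by (simp add: algebra_simps)
        also have "\<dots> \<le> real k * \<sigma> + e * real k + e * (real k + real k) + 2 * (real k * e)"
          using k3 k(4) e0 by (intro add_mono mult_left_mono order_refl) auto
        finally have "\<epsilon> * V \<le> real k * (\<sigma> - \<tau>) + 5 * (real k * e)"
          by (simp add: algebra_simps)
        also have "\<dots> \<le> real k * (2 * e) + 5 * (real k * e)"
          using \<tau>(4) by (intro add_right_mono mult_left_mono) (auto simp: \<sigma>_def)
        also have "\<dots> < 8 * (real k * e)" using k(2) e0 by simp
        also have "\<dots> = \<epsilon> * (real k * \<epsilon> ^ 2)" by (simp add: e_def power3_eq_cube power2_eq_square)
        finally have V: "V < real k * \<epsilon> ^ 2" using \<epsilon> by simp
        \<comment> \<open>Markov's inequality: the mean of X is below k \<epsilon>^2, so X reaches k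
          \<epsilon> for less than a proportion \<epsilon> of the words.\<close>
        define Bad where "Bad = {w \<in> words b n. \<not> X w < real k * \<epsilon>}"
        have "real (card Bad) * (real k * \<epsilon>) \<le> (\<Sum>w\<in>Bad. X w)"
          unfolding Bad_def by (intro sum_bounded_below) auto
        also have "\<dots> \<le> (\<Sum>w\<in>words b n. X w)"
          using X0 by (intro sum_mono2) (auto simp: Bad_def)
        also have "\<dots> = V * real b ^ n" using bn by (simp add: V_def)
        also have "\<dots> < real k * \<epsilon> ^ 2 * real b ^ n" using V bn by simp
        also have "\<dots> = (\<epsilon> * real b ^ n) * (real k * \<epsilon>)" by (simp add: power2_eq_square)
        finally have Bad: "real (card Bad) < \<epsilon> * real b ^ n" using \<epsilon> k(2) by (simp add: mult.commute)
        have "card {w \<in> words b n. X w < real k * \<epsilon>} + card Bad = card (words b n)"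
          unfolding Bad_def by (subst card_Un_disjoint[symmetric]) (auto intro!: arg_cong[where f=card])
        then have "real (card {w \<in> words b n. X w < real k * \<epsilon>}) + real (card Bad) = real b ^ n"
          unfolding card_words by (metis of_nat_add of_nat_power)
        then have "(1 - \<epsilon>) * real b ^ n < real (card {w \<in> words b n. X w < real k * \<epsilon>})"
          using Bad by (simp add: algebra_simps)
        moreover have "{w \<in> words b n. entropy_porous b (\<mu> (word_map b w 0)) \<alpha> \<epsilon> m 1 k} = {w \<in> words b n. X w < real k * \<epsilon>}"
          unfolding X_def entropy_porous_iff[OF k(2)] ..
        ultimately show "1 - \<epsilon> < real (card {w \<in> words b n. entropy_porous b (\<mu> (word_map b w 0)) \<alpha> \<epsilon> m 1 k}) / real b ^ n"
          using bn by (simp add: field_simps)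
      qed
    qed
  qed
qed

end

lemma periodic_int:
  fixes \<phi> :: "real \<Rightarrow> real"
  assumes "\<forall>x. \<phi> (x + 1) = \<phi> x"
  shows "\<phi> (x + of_int k) = \<phi> x"
proof (induction k rule: int_induct[where k=0])
  case (step1 i)
  then show ?case using assms[rule_format, of "x + of_int i"] by (simp add: add.assoc)
next
  case (step2 i)
  then show ?case using assms[rule_format, of "x + of_int (i - 1)"] by (simp add: add.assoc)
qed simp

theorem theorem5p2:
  fixes b :: nat and \<gamma> :: real and \<phi> :: "real \<Rightarrow> real" and \<alpha> :: real
  assumes "b \<ge> 2"
    and "0 < \<gamma>" and "\<gamma> < 1"
    and "\<forall>x. \<phi> (x + 1) = \<phi> x"
    and "\<exists>L. L-lipschitz_on UNIV \<phi>"
    and "condH b \<gamma> \<phi>"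
    and "0 \<le> \<alpha>" and "\<alpha> \<le> 1"
    and "AE x in lborel. x \<in> {0..1} \<longrightarrow> exact_dimensional (mx b \<gamma> \<phi> x) \<alpha>"
  shows "\<forall>\<epsilon>>0. \<exists>M1. \<forall>m\<ge>M1. \<exists>K1. \<forall>k\<ge>K1. \<exists>N1. \<forall>n\<ge>N1.
           real (card {w \<in> words b n.
                   entropy_porous b (mx b \<gamma> \<phi> (word_map b w 0)) \<alpha> \<epsilon> m 1 k}) / real b ^ n
           > 1 - \<epsilon>"
proof -
  obtain L where L: "L-lipschitz_on UNIV \<phi>" using assms(5) by blast
  \<comment> \<open>Periodicity reduces the bound to [0, 1), where \<phi> varies by at most
    \<open>L\<close> from its value at 0.\<close>
  define K where "K = \<bar>\<phi> 0\<bar> + L"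
  have "\<bar>\<phi> x\<bar> \<le> K" for x
  proof -
    have "\<phi> x = \<phi> (frac x)"
      using periodic_int[OF assms(4), of "frac x" "\<lfloor>x\<rfloor>"] by (simp add: frac_def)
    moreover have "\<bar>\<phi> (frac x) - \<phi> 0\<bar> \<le> L * \<bar>frac x - 0\<bar>"
      using lipschitz_onD[OF L, of "frac x" 0] by (simp add: dist_real_def)
    moreover have "L * \<bar>frac x - 0\<bar> \<le> L * 1"
      using lipschitz_on_nonneg[OF L] frac_lt_1[of x] frac_ge_0[of x] by (intro mult_left_mono) auto
    ultimately show ?thesis unfolding K_def by linarith
  qed
  moreover obtain A :: nat where "K / (1 - \<gamma>) < real A" using reals_Archimedean2 by blast
  ultimately interpret weierstrass b \<gamma> \<phi> L K A
    using assms(1-3) L by unfold_locales auto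
  show ?thesis using entropy_porous_typical[OF assms(7-9)] by blast
qed

end
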